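(* Let $R$ be a principal ideal domain, let $L$ be a free $R$-module of rank $f\ge1$, and let $M\subsetneq L$ be a proper submodule that is also free of rank $f$, with basis $\{u_1,\dots,u_f\}$. Let $p\in R$ be a prime and suppose that $p^{e_1},\dots,p^{e_k}$, with $k\ge 1$ and $1\le e_1\le\cdots\le e_k$, are the $p$-elementary divisors of $L/M$. Set $e=e_k$. Then: (i) There exist $v\in L$ and $a_1,\dots,a_f\in R$ such that $p^{e}v=a_1u_1+\cdots+a_fu_f$ and $p^{e-1}v\notin M$. (ii) For any such $v$ and $a_1,\dots,a_f$, the submodule $P=Rv+M$ satisfies $P/M\cong R/Rp^{e}$, and the elementary divisors of $L/P$ are those of $L/M$ with one copy of $p^{e}$ removed. (iii) For any such $v$ and $a_1,\dots,a_f$, there is an index $i$ with $p\nmid a_i$; for any such $i$ and any $x,y\in R$ with $xa_i+yp^{e}=1$, the vector $v'=xv+yu_i$ together with the $f-1$ vectors $u_j$, $j\neq i$, form an $R$-basis of $P=Rv+M$.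
   Context: The elementary divisors of the finitely generated torsion $R$-module $L/M$ are the prime powers (up to units, with multiplicity) in its decomposition as a direct sum of cyclic modules of prime power order; the $p$-elementary divisors are those that are powers of $p$. *)

theory Defs
  imports "HOL-Algebra.Ring_Divisibility" "Jordan_Normal_Form.Missing_VectorSpace"
begin

text \<open>
  The \<^term>\<open>mult\<close> and \<^term>\<open>one\<close> fields of a module record carry no meaning
  (a \<^term>\<open>module\<close> is only required to be an abelian group); as in the existing
  constructions of modules they are filled in with zero.
\<close>

definition quot_module ::
    "('a, 'b, 'm) module_scheme \<Rightarrow> 'b set \<Rightarrow> ('a, 'b set) module" where
  "quot_module L N =
    \<lparr>carrier = a_rcosets\<^bsub>L\<^esub> N, mult = (\<lambda>_ _. N), one = N, zero = N, add = set_add L,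
     smult = (\<lambda>r A. \<Union>x\<in>A. N +>\<^bsub>L\<^esub> (r \<odot>\<^bsub>L\<^esub> x))\<rparr>"

definition ring_as_module :: "('a, 'r) ring_scheme \<Rightarrow> ('a, 'a) module" where
  "ring_as_module R =
    \<lparr>carrier = carrier R, mult = mult R, one = one R, zero = zero R, add = add R,
     smult = mult R\<rparr>"

definition cyclic_module :: "('a, 'r) ring_scheme \<Rightarrow> 'a \<Rightarrow> ('a, 'a set) module" where
  "cyclic_module R d = quot_module (ring_as_module R) (PIdl\<^bsub>R\<^esub> d)"

text \<open>This is the direct product, hence the direct sum only for finite \<open>I\<close>.\<close>

definition finite_direct_sum ::
    "'i set \<Rightarrow> ('i \<Rightarrow> ('a, 'b, 'm) module_scheme) \<Rightarrow> ('a, 'i \<Rightarrow> 'b) module" where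
  "finite_direct_sum I N =
    \<lparr>carrier = (\<Pi>\<^sub>E i\<in>I. carrier (N i)),
     mult = (\<lambda>_ _. \<lambda>i\<in>I. \<zero>\<^bsub>N i\<^esub>), one = (\<lambda>i\<in>I. \<zero>\<^bsub>N i\<^esub>),
     zero = (\<lambda>i\<in>I. \<zero>\<^bsub>N i\<^esub>),
     add = (\<lambda>x y. \<lambda>i\<in>I. x i \<oplus>\<^bsub>N i\<^esub> y i),
     smult = (\<lambda>r x. \<lambda>i\<in>I. r \<odot>\<^bsub>N i\<^esub> x i)\<rparr>"

definition module_isomorphic ::
    "('a, 'r) ring_scheme \<Rightarrow> ('a, 'b, 'm) module_scheme \<Rightarrow> ('a, 'c, 'n) module_scheme \<Rightarrow> bool" where
  "module_isomorphic R M N \<longleftrightarrow> (\<exists>h. mod_hom R M N h \<and> bij_betw h (carrier M) (carrier N))"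

definition basis_family ::
    "('a, 'r) ring_scheme \<Rightarrow> ('a, 'b, 'm) module_scheme \<Rightarrow> 'i set \<Rightarrow> ('i \<Rightarrow> 'b) \<Rightarrow> bool" where
  "basis_family R N I u \<longleftrightarrow>
    inj_on u I \<and> u ` I \<subseteq> carrier N \<and>
    \<not> module.lin_dep R N (u ` I) \<and> module.span R N (u ` I) = carrier N"

definition free_of_rank ::
    "('a, 'r) ring_scheme \<Rightarrow> ('a, 'b, 'm) module_scheme \<Rightarrow> nat \<Rightarrow> bool" where
  "free_of_rank R N f \<longleftrightarrow> module R N \<and> (\<exists>b. basis_family R N {1..f} b)"

definition power_upto_unit :: "('a, 'r) ring_scheme \<Rightarrow> 'a \<Rightarrow> 'a \<Rightarrow> bool" where
  "power_upto_unit R q d \<longleftrightarrow> (\<exists>n\<ge>1. d \<sim>\<^bsub>R\<^esub> q [^]\<^bsub>R\<^esub> (n::nat))"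

text \<open>
  The list \<open>ds\<close> displays the elementary divisors of \<open>N\<close> with multiplicity.  Elementary divisors
  are determined only up to order and units, so lists of them are compared by
  \<^const>\<open>essentially_equal\<close>.
\<close>

definition elementary_divisors ::
    "('a, 'r) ring_scheme \<Rightarrow> ('a, 'b, 'm) module_scheme \<Rightarrow> 'a list \<Rightarrow> bool" where
  "elementary_divisors R N ds \<longleftrightarrow>
    (\<forall>d\<in>set ds. d \<in> carrier R \<and>
       (\<exists>q\<in>carrier R. ring_prime\<^bsub>R\<^esub> q \<and> power_upto_unit R q d)) \<and>
    module_isomorphic R N (finite_direct_sum {..<length ds} (\<lambda>i. cyclic_module R (ds ! i)))"

definition p_part :: "('a, 'r) ring_scheme \<Rightarrow> 'a \<Rightarrow> 'a list \<Rightarrow> 'a list" where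
  "p_part R p ds = filter (power_upto_unit R p) ds"

definition adjoin ::
    "('a, 'r) ring_scheme \<Rightarrow> ('a, 'b, 'm) module_scheme \<Rightarrow> 'b \<Rightarrow> 'b set \<Rightarrow> 'b set" where
  "adjoin R L v M = {r \<odot>\<^bsub>L\<^esub> v | r. r \<in> carrier R} <+>\<^bsub>L\<^esub> M"

definition is_witness ::
    "('a, 'r) ring_scheme \<Rightarrow> ('a, 'b, 'm) module_scheme \<Rightarrow> 'b set \<Rightarrow> nat \<Rightarrow> (nat \<Rightarrow> 'b) \<Rightarrow>
     'a \<Rightarrow> nat \<Rightarrow> 'b \<Rightarrow> (nat \<Rightarrow> 'a) \<Rightarrow> bool" where
  "is_witness R L M f u p e v a \<longleftrightarrow>
    v \<in> carrier L \<and> a \<in> {1..f} \<rightarrow> carrier R \<and>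
    (p [^]\<^bsub>R\<^esub> e) \<odot>\<^bsub>L\<^esub> v = (\<Oplus>\<^bsub>L\<^esub>i\<in>{1..f}. a i \<odot>\<^bsub>L\<^esub> u i) \<and>
    (p [^]\<^bsub>R\<^esub> (e - 1)) \<odot>\<^bsub>L\<^esub> v \<notin> M"

end

theory Submission
  imports Defs
begin

text \<open>
  Decompose \<open>L/M\<close> as a direct sum \<open>D\<close> of modules \<open>R/(d)\<close>, and let \<open>w\<close> be the image of a witness
  \<open>v\<close>, so \<open>p\<^sup>e w = 0 \<noteq> p\<^sup>e\<^sup>-\<^sup>1 w\<close>.  Since \<open>e\<close> is the largest exponent of \<open>p\<close>, some coordinate of \<open>w\<close>
  lies in a summand \<open>R/(p\<^sup>e)\<close> and is represented by an element prime to \<open>p\<close>, hence generates that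
  summand and has the same annihilator as \<open>w\<close>.  So \<open>Rw\<close> is a complement of the sum of the other
  summands, and \<open>L/P = D/Rw\<close> is isomorphic to the latter; the uniqueness of elementary divisors is
  never needed.  For the basis, put \<open>A = \<Sum>j\<noteq>i. a\<^sub>j u\<^sub>j\<close>; then \<open>p\<^sup>e v' = u\<^sub>i + x A\<close> and \<open>v = a\<^sub>i v' + y A\<close>.
\<close>

text \<open>The coordinate used for the splitting is any one at which p^(e-1) w does not vanish. Let
  R/(q^n) be its summand. If q were not associated with p, then p would act injectively on R/(q^n),
  and p^e could not kill the coordinate; hence q is p up to a unit. Maximality of e gives n \<le> e,
  and n < e is excluded because p^(e-1) would then act as zero. Taking the largest exponent is
  essential: in Z/p + Z/p^2 the element (0, p) has order p, yet it spans no direct summand. Every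
  statement about a quotient of L is rephrased as the existence of a surjection out of L with
  prescribed kernel. The map onto the decomposition of L/P is then a composite of two surjections,
  and L/P never has to be compared with (L/M)/(P/M). The index i with p not dividing a_i comes from
  torsion-freeness of L: if p divided every a_i, one factor p could be cancelled from p^e v = a_1
  u_1 + ... + a_f u_f, which would put p^(e-1) v into M.\<close>

section \<open>Quotient modules and direct sums\<close>

text \<open>All module axioms are identities or existence claims that pass to images. This gives
  quotients their module structure directly from operations on representatives, without a separate
  construction of the quotient group.\<close>

lemma module_surj_image:
  assumes "module R M"
    and im: "h ` carrier M = carrier Q"
    and zero: "h \<zero>\<^bsub>M\<^esub> = \<zero>\<^bsub>Q\<^esub>"
    and add: "\<And>x y. x \<in> carrier M \<Longrightarrow> y \<in> carrier M \<Longrightarrow> h (x \<oplus>\<^bsub>M\<^esub> y) = h x \<oplus>\<^bsub>Q\<^esub> h y"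
    and smult: "\<And>r x. r \<in> carrier R \<Longrightarrow> x \<in> carrier M \<Longrightarrow> h (r \<odot>\<^bsub>M\<^esub> x) = r \<odot>\<^bsub>Q\<^esub> h x"
  shows "module R Q"
proof -
  interpret module R M by fact
  have neg: "\<exists>w\<in>carrier Q. z \<oplus>\<^bsub>Q\<^esub> w = \<zero>\<^bsub>Q\<^esub>" if "z \<in> carrier Q" for z
  proof -
    from that im have "z \<in> h ` carrier M" by simp
    then obtain x where x: "z = h x" "x \<in> carrier M" by (rule imageE)
    have "z \<oplus>\<^bsub>Q\<^esub> h (\<ominus>\<^bsub>M\<^esub> x) = \<zero>\<^bsub>Q\<^esub>"
      using x add[of x "\<ominus>\<^bsub>M\<^esub> x"] by (simp add: zero M.r_neg)
    moreover have "h (\<ominus>\<^bsub>M\<^esub> x) \<in> carrier Q"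
      unfolding im[symmetric] using x by simp
    ultimately show ?thesis by blast
  qed
  show ?thesis
    by (rule module_criteria, rule R.is_cring)
      (use neg in \<open>auto simp: im[symmetric] zero[symmetric] add[symmetric] smult[symmetric]
        M.a_ac smult_assoc1 smult_l_distr smult_r_distr\<close>)
qed

lemma mod_homI:
  assumes "module R M" "module R N"
    and "\<And>x. x \<in> carrier M \<Longrightarrow> h x \<in> carrier N"
    and "\<And>x y. x \<in> carrier M \<Longrightarrow> y \<in> carrier M \<Longrightarrow> h (x \<oplus>\<^bsub>M\<^esub> y) = h x \<oplus>\<^bsub>N\<^esub> h y"
    and "\<And>r x. r \<in> carrier R \<Longrightarrow> x \<in> carrier M \<Longrightarrow> h (r \<odot>\<^bsub>M\<^esub> x) = r \<odot>\<^bsub>N\<^esub> h x"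
  shows "mod_hom R M N h"
  using assms by (auto simp: mod_hom_def mod_hom_axioms_def module_hom_def)

context module
begin

text \<open>Closure under negatives is not among the axioms of \<open>submodule\<close>; it comes
  from scaling by -1. The coset calculus for abelian subgroups becomes available this way.\<close>

lemma submodule_abelian_subgroup:
  assumes "submodule R N M"
  shows "abelian_subgroup N M"
proof -
  interpret N: submodule R N M by fact
  have "\<ominus>\<^bsub>M\<^esub> x \<in> N" if "x \<in> N" for x
    using N.smult_closed[of "\<ominus>\<^bsub>R\<^esub> \<one>\<^bsub>R\<^esub>" x] that subsetD[OF N.subset that] by (simp add: smult_l_minus)
  then have "subgroup N (add_monoid M)"
    using N.subset by unfold_locales (auto simp: a_inv_def)
  then show ?thesis
    by (intro abelian_subgroupI3 additive_subgroup.intro M.abelian_group_axioms)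
qed

lemma coset_eq_iff:
  assumes "submodule R N M" "x \<in> carrier M" "y \<in> carrier M"
  shows "N +>\<^bsub>M\<^esub> x = N +>\<^bsub>M\<^esub> y \<longleftrightarrow> x \<ominus>\<^bsub>M\<^esub> y \<in> N"
proof -
  interpret N: abelian_subgroup N M
    by (rule submodule_abelian_subgroup) fact
  show ?thesis
    using assms(2,3) N.a_rcos_self N.a_rcos_module a_repr_independence N.a_subgroup
    by (metis a_minus_def)
qed

lemma coset_eq_self_iff:
  assumes "submodule R N M" "x \<in> carrier M"
  shows "N +>\<^bsub>M\<^esub> x = N \<longleftrightarrow> x \<in> N"
proof -
  interpret N: abelian_subgroup N M
    by (rule submodule_abelian_subgroup) fact
  show ?thesis
    using assms(2) N.a_subgroup M.a_coset_join1 M.a_coset_join2 by blast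
qed

lemma carrier_quot_module: "carrier (quot_module M N) = (\<lambda>x. N +>\<^bsub>M\<^esub> x) ` carrier M"
  by (auto simp: quot_module_def A_RCOSETS_def')

lemma add_quot_module:
  assumes "submodule R N M" "x \<in> carrier M" "y \<in> carrier M"
  shows "(N +>\<^bsub>M\<^esub> x) \<oplus>\<^bsub>quot_module M N\<^esub> (N +>\<^bsub>M\<^esub> y) = N +>\<^bsub>M\<^esub> (x \<oplus>\<^bsub>M\<^esub> y)"
  using abelian_subgroup.a_rcos_sum[OF submodule_abelian_subgroup] assms
  by (simp add: quot_module_def)

text \<open>The scalar product is defined as a union over all representatives \<open>y\<close> of
  the coset. All members of that union agree, since \<open>r\<close> times \<open>y - x\<close>
  stays in \<open>N\<close>, and the union is not empty.\<close>

lemma smult_quot_module: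
  assumes "submodule R N M" "r \<in> carrier R" "x \<in> carrier M"
  shows "r \<odot>\<^bsub>quot_module M N\<^esub> (N +>\<^bsub>M\<^esub> x) = N +>\<^bsub>M\<^esub> (r \<odot>\<^bsub>M\<^esub> x)"
proof -
  interpret N: submodule R N M by fact
  interpret N: abelian_subgroup N M
    by (rule submodule_abelian_subgroup) fact
  have "N +>\<^bsub>M\<^esub> (r \<odot>\<^bsub>M\<^esub> y) = N +>\<^bsub>M\<^esub> (r \<odot>\<^bsub>M\<^esub> x)" if y: "y \<in> N +>\<^bsub>M\<^esub> x" for y
  proof -
    have yc: "y \<in> carrier M"
      using y assms N.a_elemrcos_carrier by blast
    have "y \<ominus>\<^bsub>M\<^esub> x \<in> N"
      using N.a_rcos_module y yc assms by (simp add: a_minus_def)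
    then have "r \<odot>\<^bsub>M\<^esub> (y \<ominus>\<^bsub>M\<^esub> x) \<in> N"
      using assms by blast
    then have "r \<odot>\<^bsub>M\<^esub> y \<ominus>\<^bsub>M\<^esub> r \<odot>\<^bsub>M\<^esub> x \<in> N"
      using assms yc by (simp add: a_minus_def smult_r_distr smult_r_minus)
    then show ?thesis
      using coset_eq_iff[OF assms(1)] assms yc by simp
  qed
  moreover have "N +>\<^bsub>M\<^esub> x \<noteq> {}"
    using N.a_rcos_self assms(3) by blast
  ultimately show ?thesis
    by (simp add: quot_module_def)
qed

lemma quot_module_is_module:
  assumes "submodule R N M"
  shows "module R (quot_module M N)"
proof (rule module_surj_image)
  show "module R M" by (rule module_axioms)
  interpret N: submodule R N M by fact
  show "N +>\<^bsub>M\<^esub> \<zero>\<^bsub>M\<^esub> = \<zero>\<^bsub>quot_module M N\<^esub>"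
    using coset_eq_self_iff[OF assms] by (simp add: quot_module_def)
qed (simp_all add: carrier_quot_module add_quot_module smult_quot_module assms)

lemma coset_mod_hom:
  assumes "submodule R N M"
  shows "mod_hom R M (quot_module M N) (\<lambda>x. N +>\<^bsub>M\<^esub> x)"
  using quot_module_is_module[OF assms]
  by (intro mod_homI module_axioms)
    (simp_all add: carrier_quot_module add_quot_module smult_quot_module assms)

end

text \<open>The first isomorphism theorem and its converse. It is used in one direction to turn the
  given decomposition of L/M into a map on L, and in the other to recognise a quotient from a
  surjection and its kernel.\<close>

lemma module_isomorphic_quot_iff:
  assumes "module R M" "submodule R N M"
  shows "module_isomorphic R (quot_module M N) D \<longleftrightarrow>
    (\<exists>h. mod_hom R M D h \<and> h ` carrier M = carrier D \<and>
      (\<forall>x\<in>carrier M. h x = \<zero>\<^bsub>D\<^esub> \<longleftrightarrow> x \<in> N))"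
proof
  interpret module R M by fact
  let ?c = "\<lambda>x. N +>\<^bsub>M\<^esub> x"
  {
    assume "module_isomorphic R (quot_module M N) D"
    then obtain g where g: "mod_hom R (quot_module M N) D g"
      "bij_betw g (carrier (quot_module M N)) (carrier D)"
      by (auto simp: module_isomorphic_def)
    interpret g: mod_hom R "quot_module M N" D g by fact
    interpret c: mod_hom R M "quot_module M N" ?c
      by (rule coset_mod_hom) fact
    have "mod_hom R M D (g \<circ> ?c)"
      by (rule mod_homI) (use c.f_im in \<open>auto intro: module_axioms g.N.module_axioms\<close>)
    moreover have "(g \<circ> ?c) ` carrier M = carrier D"
      using g(2) by (simp add: image_image carrier_quot_module bij_betw_def)
    moreover have "(g \<circ> ?c) x = \<zero>\<^bsub>D\<^esub> \<longleftrightarrow> x \<in> N" if "x \<in> carrier M" for x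
    proof -
      have "(g \<circ> ?c) x = \<zero>\<^bsub>D\<^esub> \<longleftrightarrow> g (?c x) = g \<zero>\<^bsub>quot_module M N\<^esub>"
        by simp
      also have "\<dots> \<longleftrightarrow> ?c x = \<zero>\<^bsub>quot_module M N\<^esub>"
        using g(2) that c.f_im
        by (intro inj_on_eq_iff[of g "carrier (quot_module M N)"]) (auto simp: bij_betw_def)
      also have "\<dots> \<longleftrightarrow> x \<in> N"
        using coset_eq_self_iff[OF assms(2) that] by (simp add: quot_module_def)
      finally show ?thesis .
    qed
    ultimately show "\<exists>h. mod_hom R M D h \<and> h ` carrier M = carrier D \<and>
      (\<forall>x\<in>carrier M. h x = \<zero>\<^bsub>D\<^esub> \<longleftrightarrow> x \<in> N)" by blast
  next
    assume "\<exists>h. mod_hom R M D h \<and> h ` carrier M = carrier D \<and>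
      (\<forall>x\<in>carrier M. h x = \<zero>\<^bsub>D\<^esub> \<longleftrightarrow> x \<in> N)"
    then obtain h where h: "mod_hom R M D h" "h ` carrier M = carrier D"
      "\<And>x. x \<in> carrier M \<Longrightarrow> h x = \<zero>\<^bsub>D\<^esub> \<longleftrightarrow> x \<in> N"
      by blast
    interpret h: mod_hom R M D h by fact
    \<comment> \<open>Scaling by -1 gives compatibility with differences, so two elements have equal
      images exactly when they lie in one coset of \<open>N\<close>; this makes the choice of a
      representative in \<open>g\<close> harmless.\<close>
    have h_diff: "h (x \<ominus>\<^bsub>M\<^esub> y) = h x \<ominus>\<^bsub>D\<^esub> h y" if "x \<in> carrier M" "y \<in> carrier M" for x y
      using that h.f_smult[of "\<ominus>\<^bsub>R\<^esub> \<one>\<^bsub>R\<^esub>" y] h.f_im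
      by (simp add: a_minus_def smult_l_minus h.N.smult_l_minus)
    have h_eq: "h x = h y \<longleftrightarrow> ?c x = ?c y" if "x \<in> carrier M" "y \<in> carrier M" for x y
      using that h(3)[of "x \<ominus>\<^bsub>M\<^esub> y"] h.f_im
      by (simp add: coset_eq_iff[OF assms(2)] h_diff)
    define g where "g A = h (SOME x. x \<in> carrier M \<and> ?c x = A)" for A
    have g: "g (?c x) = h x" if "x \<in> carrier M" for x
      unfolding g_def using that h_eq by (rule_tac someI2[of _ x]) auto
    have "mod_hom R (quot_module M N) D g"
      by (rule mod_homI)
        (use h.f_im in \<open>auto intro: quot_module_is_module assms h.N.module_axioms
          simp: carrier_quot_module add_quot_module smult_quot_module assms g\<close>)
    moreover have "bij_betw g (carrier (quot_module M N)) (carrier D)"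
      unfolding bij_betw_def inj_on_def carrier_quot_module h(2)[symmetric]
      by (auto simp: g h_eq image_image)
    ultimately show "module_isomorphic R (quot_module M N) D"
      by (auto simp: module_isomorphic_def)
  }
qed

lemma module_isomorphic_sym:
  assumes "module_isomorphic R M N"
  shows "module_isomorphic R N M"
proof -
  obtain h where h: "mod_hom R M N h" "bij_betw h (carrier M) (carrier N)"
    using assms by (auto simp: module_isomorphic_def)
  interpret h: mod_hom R M N h by fact
  let ?g = "inv_into (carrier M) h"
  have g: "bij_betw ?g (carrier N) (carrier M)"
    using h(2) by (rule bij_betw_inv_into)
  have gc: "?g y \<in> carrier M" if "y \<in> carrier N" for y
    using g that by (auto simp: bij_betw_def)
  have hg: "h (?g y) = y" if "y \<in> carrier N" for y
    using h(2) that by (simp add: bij_betw_inv_into_right)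
  have gh: "?g y = x" if "x \<in> carrier M" "h x = y" for x y
    using h(2) that by (auto simp: bij_betw_inv_into_left)
  have "mod_hom R N M ?g"
    by (rule mod_homI) (auto intro!: gh gc simp: hg gc h.M.module_axioms h.N.module_axioms)
  then show ?thesis
    using g by (auto simp: module_isomorphic_def)
qed

section \<open>The modules R, R/(d) and direct sums\<close>

lemma (in cring) ring_as_module_is_module: "module R (ring_as_module R)"
proof -
  have "\<exists>w\<in>carrier R. v \<oplus> w = \<zero>" if "v \<in> carrier R" for v
    using r_neg that by (intro bexI[of _ "\<ominus> v"]) auto
  then show ?thesis
    by (intro module_criteria)
      (simp_all add: ring_as_module_def is_cring m_assoc l_distr r_distr a_ac)
qed

lemma (in cring) PIdl_submodule:
  assumes "d \<in> carrier R"
  shows "submodule R (PIdl d) (ring_as_module R)"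
proof -
  interpret I: ideal "PIdl d" R
    using assms by (rule cgenideal_ideal)
  show ?thesis
    by (rule submodule.intro, rule ring_as_module_is_module)
      (use I.a_subset in \<open>simp_all add: ring_as_module_def I.I_l_closed\<close>)
qed

lemma finite_direct_sum_is_module:
  assumes "cring R" "\<And>i. i \<in> I \<Longrightarrow> module R (N i)"
  shows "module R (finite_direct_sum I N)"
proof -
  have ag: "abelian_group (N i)" if "i \<in> I" for i
    using assms(2)[OF that] by (simp add: module_def)
  have *: "x i \<in> carrier (N i)" if "x \<in> (\<Pi>\<^sub>E i\<in>I. carrier (N i))" "i \<in> I" for x i
    using that by (auto simp: PiE_def Pi_def)
  note simps = module.smult_closed[OF assms(2)] module.smult_assoc1[OF assms(2)]
    module.smult_l_distr[OF assms(2)] module.smult_r_distr[OF assms(2)]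
    module.smult_one[OF assms(2)]
    abelian_monoid.a_closed[OF abelian_group.axioms(1)[OF ag]]
    abelian_monoid.zero_closed[OF abelian_group.axioms(1)[OF ag]]
    abelian_monoid.a_assoc[OF abelian_group.axioms(1)[OF ag]]
    abelian_monoid.r_zero[OF abelian_group.axioms(1)[OF ag]]
    abelian_group.r_neg[OF ag] abelian_group.a_inv_closed[OF ag]
  show ?thesis
  proof (rule module_criteria)
    show "cring R" by fact
    show "\<forall>v\<in>carrier (finite_direct_sum I N). \<exists>w\<in>carrier (finite_direct_sum I N).
        v \<oplus>\<^bsub>finite_direct_sum I N\<^esub> w = \<zero>\<^bsub>finite_direct_sum I N\<^esub>"
    proof
      fix v assume v: "v \<in> carrier (finite_direct_sum I N)"
      show "\<exists>w\<in>carrier (finite_direct_sum I N).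
          v \<oplus>\<^bsub>finite_direct_sum I N\<^esub> w = \<zero>\<^bsub>finite_direct_sum I N\<^esub>"
        by (rule bexI[of _ "\<lambda>i\<in>I. \<ominus>\<^bsub>N i\<^esub> v i"])
          (use v in \<open>auto simp: finite_direct_sum_def * simps cong: restrict_cong\<close>)
    qed
    show "\<forall>v\<in>carrier (finite_direct_sum I N).
        v \<oplus>\<^bsub>finite_direct_sum I N\<^esub> \<zero>\<^bsub>finite_direct_sum I N\<^esub> = v"
      by (auto simp: finite_direct_sum_def * simps PiE_def extensional_def intro!: ext)
    show "\<forall>v w. v \<in> carrier (finite_direct_sum I N) \<and> w \<in> carrier (finite_direct_sum I N) \<longrightarrow>
        v \<oplus>\<^bsub>finite_direct_sum I N\<^esub> w = w \<oplus>\<^bsub>finite_direct_sum I N\<^esub> v"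
      by (auto simp: finite_direct_sum_def
          intro!: restrict_ext abelian_monoid.a_comm[OF abelian_group.axioms(1)[OF ag]] *)
    show "\<forall>v\<in>carrier (finite_direct_sum I N). \<one>\<^bsub>R\<^esub> \<odot>\<^bsub>finite_direct_sum I N\<^esub> v = v"
      by (auto simp: finite_direct_sum_def * simps PiE_def extensional_def intro!: ext)
  qed (use assms(1) in \<open>auto simp: finite_direct_sum_def * simps cring.cring_simprules
        intro!: restrict_ext\<close>)
qed

lemma (in cring) cyclic_module_is_module:
  assumes "d \<in> carrier R"
  shows "module R (cyclic_module R d)"
  unfolding cyclic_module_def
  using module.quot_module_is_module[OF ring_as_module_is_module PIdl_submodule[OF assms]] .

section \<open>Splitting off a cyclic summand\<close>

text \<open>By \<open>gen\<close> and \<open>ann\<close>, \<open>\<pi>\<close> maps the cyclic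
  submodule Rw bijectively onto \<open>E\<close>. Hence D is the direct sum of Rw and the kernel of
  \<open>\<pi>\<close>, and \<open>q\<close> is the projection onto that kernel along Rw.\<close>

lemma cyclic_complement:
  assumes "mod_hom R D E \<pi>" and w: "w \<in> carrier D"
    and gen: "\<And>z. z \<in> carrier E \<Longrightarrow> \<exists>r\<in>carrier R. z = r \<odot>\<^bsub>E\<^esub> \<pi> w"
    and ann: "\<And>r. r \<in> carrier R \<Longrightarrow> r \<odot>\<^bsub>E\<^esub> \<pi> w = \<zero>\<^bsub>E\<^esub> \<Longrightarrow> r \<odot>\<^bsub>D\<^esub> w = \<zero>\<^bsub>D\<^esub>"
  obtains q where "mod_hom R D D q"
    and "\<And>z. z \<in> carrier D \<Longrightarrow> q z = \<zero>\<^bsub>D\<^esub> \<longleftrightarrow> (\<exists>r\<in>carrier R. z = r \<odot>\<^bsub>D\<^esub> w)"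
    and "\<And>z. z \<in> carrier D \<Longrightarrow> \<pi> (q z) = \<zero>\<^bsub>E\<^esub>"
    and "\<And>z. z \<in> carrier D \<Longrightarrow> \<pi> z = \<zero>\<^bsub>E\<^esub> \<Longrightarrow> q z = z"
proof -
  interpret \<pi>: mod_hom R D E \<pi> by fact
  have im: "\<pi> z \<in> carrier E" if "z \<in> carrier D" for z
    using \<pi>.f_im that by blast
  \<comment> \<open>\<open>c z\<close> is determined only modulo the annihilator of \<open>\<pi> w\<close>, which by \<open>ann\<close> kills \<open>w\<close>;
    hence \<open>c z \<odot> w\<close> depends additively and linearly on \<open>z\<close>.\<close>
  define c where "c z = (SOME r. r \<in> carrier R \<and> \<pi> z = r \<odot>\<^bsub>E\<^esub> \<pi> w)" for z
  have c: "c z \<in> carrier R" "\<pi> z = c z \<odot>\<^bsub>E\<^esub> \<pi> w" if "z \<in> carrier D" for z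
  proof -
    have "\<exists>r. r \<in> carrier R \<and> \<pi> z = r \<odot>\<^bsub>E\<^esub> \<pi> w"
      using gen[OF im[OF that]] by blast
    from someI_ex[OF this] show "c z \<in> carrier R" "\<pi> z = c z \<odot>\<^bsub>E\<^esub> \<pi> w"
      unfolding c_def by blast+
  qed
  have cw: "c z \<odot>\<^bsub>D\<^esub> w = r \<odot>\<^bsub>D\<^esub> w"
    if z: "z \<in> carrier D" and r: "r \<in> carrier R" "\<pi> z = r \<odot>\<^bsub>E\<^esub> \<pi> w" for z r
  proof -
    have diff: "(c z \<ominus>\<^bsub>R\<^esub> r) \<odot>\<^bsub>D\<^esub> w = c z \<odot>\<^bsub>D\<^esub> w \<ominus>\<^bsub>D\<^esub> r \<odot>\<^bsub>D\<^esub> w"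
      using c[OF z] r w by (simp add: a_minus_def \<pi>.M.smult_l_distr \<pi>.M.smult_l_minus)
    have "(c z \<ominus>\<^bsub>R\<^esub> r) \<odot>\<^bsub>E\<^esub> \<pi> w = c z \<odot>\<^bsub>E\<^esub> \<pi> w \<ominus>\<^bsub>E\<^esub> r \<odot>\<^bsub>E\<^esub> \<pi> w"
      using c[OF z] r im[OF w] by (simp add: a_minus_def \<pi>.N.smult_l_distr \<pi>.N.smult_l_minus)
    also have "\<dots> = \<zero>\<^bsub>E\<^esub>"
      using c[OF z] r im[OF w] by (simp add: a_minus_def \<pi>.N.M.r_neg)
    finally have "(c z \<ominus>\<^bsub>R\<^esub> r) \<odot>\<^bsub>D\<^esub> w = \<zero>\<^bsub>D\<^esub>"
      using ann[of "c z \<ominus>\<^bsub>R\<^esub> r"] c[OF z] r by simp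
    then show ?thesis
      using diff c[OF z] r w by simp
  qed
  define q where "q z = z \<ominus>\<^bsub>D\<^esub> c z \<odot>\<^bsub>D\<^esub> w" for z
  have qr: "q z = z \<ominus>\<^bsub>D\<^esub> r \<odot>\<^bsub>D\<^esub> w"
    if "z \<in> carrier D" "r \<in> carrier R" "\<pi> z = r \<odot>\<^bsub>E\<^esub> \<pi> w" for z r
    unfolding q_def using cw[OF that] by simp
  have qc: "q z \<in> carrier D" if "z \<in> carrier D" for z
    using c[OF that] that w by (simp add: q_def)
  show thesis
  proof
    show "mod_hom R D D q"
    proof (rule mod_homI)
      fix x y assume xy: "x \<in> carrier D" "y \<in> carrier D"
      have "q (x \<oplus>\<^bsub>D\<^esub> y) = (x \<oplus>\<^bsub>D\<^esub> y) \<ominus>\<^bsub>D\<^esub> (c x \<oplus>\<^bsub>R\<^esub> c y) \<odot>\<^bsub>D\<^esub> w"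
        using xy c[OF xy(1)] c[OF xy(2)] im[OF w]
        by (intro qr) (simp_all add: \<pi>.N.smult_l_distr)
      also have "\<dots> = q x \<oplus>\<^bsub>D\<^esub> q y"
        using xy c[OF xy(1)] c[OF xy(2)] w
        by (simp add: q_def \<pi>.M.smult_l_distr a_minus_def \<pi>.M.M.minus_add \<pi>.M.M.a_ac)
      finally show "q (x \<oplus>\<^bsub>D\<^esub> y) = q x \<oplus>\<^bsub>D\<^esub> q y" .
    next
      fix r x assume rx: "r \<in> carrier R" "x \<in> carrier D"
      have "q (r \<odot>\<^bsub>D\<^esub> x) = r \<odot>\<^bsub>D\<^esub> x \<ominus>\<^bsub>D\<^esub> (r \<otimes>\<^bsub>R\<^esub> c x) \<odot>\<^bsub>D\<^esub> w"
        using rx c[OF rx(2)] im[OF w]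
        by (intro qr) (simp_all add: \<pi>.N.smult_assoc1)
      also have "\<dots> = r \<odot>\<^bsub>D\<^esub> q x"
        using rx c[OF rx(2)] w
        by (simp add: q_def \<pi>.M.smult_r_distr \<pi>.M.smult_r_minus a_minus_def \<pi>.M.smult_assoc1)
      finally show "q (r \<odot>\<^bsub>D\<^esub> x) = r \<odot>\<^bsub>D\<^esub> q x" .
    qed (use qc in \<open>auto intro: \<pi>.M.module_axioms\<close>)
  next
    fix z assume z: "z \<in> carrier D"
    show "q z = \<zero>\<^bsub>D\<^esub> \<longleftrightarrow> (\<exists>r\<in>carrier R. z = r \<odot>\<^bsub>D\<^esub> w)"
    proof
      assume "q z = \<zero>\<^bsub>D\<^esub>"
      then show "\<exists>r\<in>carrier R. z = r \<odot>\<^bsub>D\<^esub> w"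
        using z c[OF z] w by (intro bexI[of _ "c z"]) (simp_all add: q_def)
    next
      assume "\<exists>r\<in>carrier R. z = r \<odot>\<^bsub>D\<^esub> w"
      then obtain r where r: "r \<in> carrier R" "z = r \<odot>\<^bsub>D\<^esub> w" by blast
      then have "q z = z \<ominus>\<^bsub>D\<^esub> r \<odot>\<^bsub>D\<^esub> w"
        using z w by (intro qr) simp_all
      then show "q z = \<zero>\<^bsub>D\<^esub>"
        using r z by (simp add: a_minus_def \<pi>.M.M.r_neg)
    qed
    have "\<pi> (q z) = \<pi> z \<ominus>\<^bsub>E\<^esub> c z \<odot>\<^bsub>E\<^esub> \<pi> w"
      using z c[OF z] w im[OF w] \<pi>.f_smult[of "\<ominus>\<^bsub>R\<^esub> c z" w]
      by (simp add: q_def a_minus_def \<pi>.M.smult_l_minus \<pi>.N.smult_l_minus)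
    then show "\<pi> (q z) = \<zero>\<^bsub>E\<^esub>"
      using c[OF z] im[OF z] by (simp add: a_minus_def \<pi>.N.M.r_neg)
    \<comment> \<open>Here 0 is an admissible coefficient of \<open>z\<close>, so nothing is
      subtracted.\<close>
    assume "\<pi> z = \<zero>\<^bsub>E\<^esub>"
    then have "q z = z \<ominus>\<^bsub>D\<^esub> \<zero>\<^bsub>R\<^esub> \<odot>\<^bsub>D\<^esub> w"
      using z w im[OF w] by (intro qr) simp_all
    then show "q z = z"
      using z w by (simp add: a_minus_def)
  qed
qed

lemma finite_direct_sum_simps:
  "carrier (finite_direct_sum I N) = (\<Pi>\<^sub>E i\<in>I. carrier (N i))"
  "\<zero>\<^bsub>finite_direct_sum I N\<^esub> = (\<lambda>i\<in>I. \<zero>\<^bsub>N i\<^esub>)"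
  "x \<oplus>\<^bsub>finite_direct_sum I N\<^esub> y = (\<lambda>i\<in>I. x i \<oplus>\<^bsub>N i\<^esub> y i)"
  "r \<odot>\<^bsub>finite_direct_sum I N\<^esub> x = (\<lambda>i\<in>I. r \<odot>\<^bsub>N i\<^esub> x i)"
  by (simp_all add: finite_direct_sum_def)

lemma finite_direct_sum_eqI:
  assumes "x \<in> carrier (finite_direct_sum I N)" "y \<in> carrier (finite_direct_sum I N)"
    and "\<And>i. i \<in> I \<Longrightarrow> x i = y i"
  shows "x = y"
  using assms by (auto simp: finite_direct_sum_simps intro: PiE_ext)

text \<open>The kernel of the \<open>j\<close>-th coordinate map is the sum of the other summands,
  so projecting along Rw and then forgetting coordinate \<open>j\<close> has kernel Rw. The
  reindexing \<open>\<sigma>\<close> is there because deleting a list entry renumbers the later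
  ones.\<close>

lemma finite_direct_sum_mod_cyclic:
  fixes I and N :: "'i \<Rightarrow> ('a, 'b, 'm) module_scheme" and \<sigma> :: "'k \<Rightarrow> 'i"
  defines "D \<equiv> finite_direct_sum I N"
  assumes R: "cring R" and N: "\<And>i. i \<in> I \<Longrightarrow> module R (N i)"
    and j: "j \<in> I" and \<sigma>: "bij_betw \<sigma> K (I - {j})" and w: "w \<in> carrier D"
    and gen: "\<And>z. z \<in> carrier (N j) \<Longrightarrow> \<exists>r\<in>carrier R. z = r \<odot>\<^bsub>N j\<^esub> w j"
    and ann: "\<And>r. r \<in> carrier R \<Longrightarrow> r \<odot>\<^bsub>N j\<^esub> w j = \<zero>\<^bsub>N j\<^esub> \<Longrightarrow> r \<odot>\<^bsub>D\<^esub> w = \<zero>\<^bsub>D\<^esub>"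
  obtains T where "mod_hom R D (finite_direct_sum K (\<lambda>k. N (\<sigma> k))) T"
    and "T ` carrier D = carrier (finite_direct_sum K (\<lambda>k. N (\<sigma> k)))"
    and "\<And>z. z \<in> carrier D \<Longrightarrow>
      T z = \<zero>\<^bsub>finite_direct_sum K (\<lambda>k. N (\<sigma> k))\<^esub> \<longleftrightarrow> (\<exists>r\<in>carrier R. z = r \<odot>\<^bsub>D\<^esub> w)"
proof -
  let ?D' = "finite_direct_sum K (\<lambda>k. N (\<sigma> k))"
  have D: "module R D"
    unfolding D_def using R N by (rule finite_direct_sum_is_module)
  have \<sigma>I: "\<sigma> k \<in> I" "\<sigma> k \<noteq> j" if "k \<in> K" for k
    using \<sigma> that by (auto simp: bij_betw_def)
  have D': "module R ?D'"
    using R N \<sigma>I by (intro finite_direct_sum_is_module) auto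
  note Ds = finite_direct_sum_simps[where I=I and N=N, folded D_def]
  note D's = finite_direct_sum_simps[where I=K and N="\<lambda>k. N (\<sigma> k)"]
  have "mod_hom R D (N j) (\<lambda>z. z j)"
    by (rule mod_homI[OF D N[OF j]]) (use j in \<open>auto simp: Ds\<close>)
  then obtain q where q: "mod_hom R D D q"
    and q0: "\<And>z. z \<in> carrier D \<Longrightarrow> q z = \<zero>\<^bsub>D\<^esub> \<longleftrightarrow> (\<exists>r\<in>carrier R. z = r \<odot>\<^bsub>D\<^esub> w)"
    and qj: "\<And>z. z \<in> carrier D \<Longrightarrow> q z j = \<zero>\<^bsub>N j\<^esub>"
    and qid: "\<And>z. z \<in> carrier D \<Longrightarrow> z j = \<zero>\<^bsub>N j\<^esub> \<Longrightarrow> q z = z"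
    using cyclic_complement[of R D "N j" "\<lambda>z. z j" w] w gen ann by blast
  interpret q: mod_hom R D D q by fact
  have qD: "q z \<in> carrier D" if "z \<in> carrier D" for z
    using q.f_im that by blast
  define T where "T z = (\<lambda>k\<in>K. q z (\<sigma> k))" for z
  have T: "T z \<in> carrier ?D'" if "z \<in> carrier D" for z
    using qD[OF that] \<sigma>I by (auto simp: T_def Ds D's)
  have q_add: "q (x \<oplus>\<^bsub>D\<^esub> y) i = q x i \<oplus>\<^bsub>N i\<^esub> q y i"
    if "x \<in> carrier D" "y \<in> carrier D" "i \<in> I" for x y i
    using that by (subst q.f_add) (simp_all add: Ds(3))
  have q_smult: "q (r \<odot>\<^bsub>D\<^esub> x) i = r \<odot>\<^bsub>N i\<^esub> q x i"
    if "r \<in> carrier R" "x \<in> carrier D" "i \<in> I" for r x i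
    using that by (subst q.f_smult) (simp_all add: Ds(4))
  show thesis
  proof
    show "mod_hom R D ?D' T"
      using T \<sigma>I by (intro mod_homI[OF D D'])
        (auto simp: T_def D's(3,4) q_add q_smult
            simp del: q.f_add q.f_smult intro!: restrict_ext)
  next
    show "T ` carrier D = carrier ?D'"
    proof (intro equalityI subsetI)
      fix y assume y: "y \<in> carrier ?D'"
      \<comment> \<open>Extension of \<open>y\<close> by zero at \<open>j\<close>: it lies in the
        kernel of the \<open>j\<close>-th coordinate, which \<open>q\<close> fixes
        pointwise.\<close>
      define z where "z = (\<lambda>i\<in>I. if i = j then \<zero>\<^bsub>N j\<^esub> else y (inv_into K \<sigma> i))"
      have inv: "inv_into K \<sigma> i \<in> K" "\<sigma> (inv_into K \<sigma> i) = i" if "i \<in> I" "i \<noteq> j" for i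
        using \<sigma> that by (auto simp: bij_betw_def inv_into_into f_inv_into_f)
      have "z i \<in> carrier (N i)" if "i \<in> I" for i
      proof (cases "i = j")
        case True
        then show ?thesis
          using abelian_group.axioms(1)[OF module.axioms(2)[OF N[OF j]]] that
          by (simp add: z_def abelian_monoid.zero_closed)
      next
        case False
        have "y (inv_into K \<sigma> i) \<in> carrier (N (\<sigma> (inv_into K \<sigma> i)))"
          using y inv(1)[OF that False] unfolding D's by (rule PiE_mem)
        then show ?thesis
          using False inv(2)[OF that False] that by (simp add: z_def)
      qed
      then have z: "z \<in> carrier D"
        by (auto simp: Ds z_def)
      have "q z = z"
        using j by (intro qid z) (simp add: z_def)
      then have "T z k = y k" if "k \<in> K" for k
        using \<sigma>I[OF that] \<sigma> that by (simp add: T_def z_def bij_betw_inv_into_left)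
      then have "T z = y"
        using finite_direct_sum_eqI[OF T[OF z] y] by blast
      then show "y \<in> T ` carrier D"
        using z by blast
    qed (use T in blast)
  next
    fix z assume z: "z \<in> carrier D"
    have "T z = \<zero>\<^bsub>?D'\<^esub> \<longleftrightarrow> (\<forall>k\<in>K. q z (\<sigma> k) = \<zero>\<^bsub>N (\<sigma> k)\<^esub>)"
      by (auto simp: T_def D's fun_eq_iff restrict_def)
    also have "\<dots> \<longleftrightarrow> (\<forall>i\<in>\<sigma> ` K. q z i = \<zero>\<^bsub>N i\<^esub>)"
      by auto
    \<comment> \<open>Coordinate \<open>j\<close> may be added for free, because \<open>q z\<close>
      always vanishes there.\<close>
    also have "\<dots> \<longleftrightarrow> (\<forall>i\<in>I. q z i = \<zero>\<^bsub>N i\<^esub>)"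
      using \<sigma> qj[OF z] by (auto simp: bij_betw_def)
    also have "\<dots> \<longleftrightarrow> q z = \<zero>\<^bsub>D\<^esub>"
    proof
      assume "\<forall>i\<in>I. q z i = \<zero>\<^bsub>N i\<^esub>"
      then show "q z = \<zero>\<^bsub>D\<^esub>"
        using finite_direct_sum_eqI[of "q z" I N "\<zero>\<^bsub>D\<^esub>"] qD[OF z] q.M.M.zero_closed
        by (simp add: D_def Ds(2)[unfolded D_def])
    qed (simp add: Ds(2))
    finally show "T z = \<zero>\<^bsub>?D'\<^esub> \<longleftrightarrow> (\<exists>r\<in>carrier R. z = r \<odot>\<^bsub>D\<^esub> w)"
      using q0[OF z] by simp
  qed
qed

section \<open>Prime powers and cyclic modules\<close>

lemma (in cring) mem_PIdl_iff:
  assumes "d \<in> carrier R"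
  shows "x \<in> PIdl d \<longleftrightarrow> d divides x"
  using assms by (auto simp: cgenideal_def factor_def m_comm)

lemma (in cring) carrier_cyclic_module:
  "carrier (cyclic_module R d) = (\<lambda>b. PIdl d +>\<^bsub>ring_as_module R\<^esub> b) ` carrier R"
  unfolding cyclic_module_def
  using module.carrier_quot_module[OF ring_as_module_is_module]
  by (simp add: ring_as_module_def)

lemma (in cring) smult_cyclic_module:
  assumes "d \<in> carrier R" "r \<in> carrier R" "b \<in> carrier R"
  shows "r \<odot>\<^bsub>cyclic_module R d\<^esub> (PIdl d +>\<^bsub>ring_as_module R\<^esub> b) = PIdl d +>\<^bsub>ring_as_module R\<^esub> (r \<otimes> b)"
  unfolding cyclic_module_def
  using module.smult_quot_module[OF ring_as_module_is_module PIdl_submodule[OF assms(1)], of r b] assms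
  by (simp add: ring_as_module_def)

lemma (in cring) cyclic_module_eq_zero_iff:
  assumes "d \<in> carrier R" "b \<in> carrier R"
  shows "PIdl d +>\<^bsub>ring_as_module R\<^esub> b = \<zero>\<^bsub>cyclic_module R d\<^esub> \<longleftrightarrow> d divides b"
  using module.coset_eq_self_iff[OF ring_as_module_is_module PIdl_submodule[OF assms(1)], of b] assms
  by (simp add: cyclic_module_def quot_module_def mem_PIdl_iff) (simp add: ring_as_module_def)

lemma (in cring) divides_nat_pow:
  assumes "a \<in> carrier R" "b \<in> carrier R" "a divides b"
  shows "a [^] (n::nat) divides b [^] n"
  using assms by (auto simp: factor_def nat_pow_distrib)

lemma (in cring) nat_pow_divides_nat_pow:
  assumes "a \<in> carrier R" "m \<le> (n::nat)"
  shows "a [^] m divides a [^] n"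
  using assms by (intro dividesI[of "a [^] (n - m)"]) (simp_all add: nat_pow_mult)

lemma (in cring) prime_divides_nat_pow:
  assumes "prime R q" "q \<in> carrier R" "a \<in> carrier R" "q divides a [^] (n::nat)"
  shows "q divides a"
  using assms(4)
proof (induction n)
  case 0
  then have "q divides \<one>" by simp
  then show ?case
    using assms divides_one by (auto simp: prime_def)
next
  case (Suc n)
  then show ?case
    using assms by (auto simp: prime_def)
qed

lemma (in domain) nat_pow_nonzero:
  assumes "a \<in> carrier R" "a \<noteq> \<zero>"
  shows "a [^] (n::nat) \<noteq> \<zero>"
  using assms by (induction n) (simp_all add: integral_iff)

text \<open>Factors \<open>q\<close> are moved from the power into \<open>b\<close> one at a time:
  primality gives \<open>q\<close> dividing \<open>b\<close>, and one \<open>q\<close> is cancelled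
  on both sides. Factorizations into primes do not enter.\<close>

lemma (in domain) prime_power_divides_cancel:
  assumes q: "ring_prime q" "q \<in> carrier R" and a: "a \<in> carrier R" "\<not> q divides a"
    and "b \<in> carrier R" "q [^] (n::nat) divides a \<otimes> b"
  shows "q [^] n divides b"
  using assms(5,6)
proof (induction n arbitrary: b)
  case 0
  then show ?case by (auto simp: one_divides)
next
  case (Suc n)
  have q0: "q \<noteq> \<zero>" "prime R q"
    using q by (auto simp: ring_prime_def)
  have "q divides q [^] Suc n"
    using q nat_pow_divides_nat_pow[of q 1 "Suc n"] by simp
  then have "q divides a \<otimes> b"
    using Suc.prems a q divides_trans by (metis nat_pow_closed)
  then have "q divides b"
    using a q q0 Suc.prems by (auto simp: prime_def)
  then obtain t where t: "t \<in> carrier R" "b = q \<otimes> t"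
    by (auto simp: factor_def)
  have "q \<otimes> q [^] n divides q \<otimes> (a \<otimes> t)"
    using Suc.prems(2) q a t by (simp add: m_ac)
  then have "q [^] n divides a \<otimes> t"
    using q q0 a t by (intro mult_divides[of "q [^] n" "a \<otimes> t" q]) auto
  then have "q [^] n divides t"
    using Suc.IH t by blast
  then have "q \<otimes> q [^] n divides q \<otimes> t"
    using q by (intro divides_mult) auto
  then show ?case
    using t q by (simp add: m_comm)
qed

text \<open>Write p = q c. Primality of p leaves p dividing q, as wanted, or p dividing c; the
  latter, after cancelling p, makes q a unit.\<close>

lemma (in domain) primes_associated:
  assumes "ring_prime p" "ring_prime q" "p \<in> carrier R" "q \<in> carrier R" "q divides p"
  shows "p \<sim> q"
proof -
  obtain c where c: "c \<in> carrier R" "p = q \<otimes> c"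
    using assms by (auto simp: factor_def)
  have "\<not> p divides c"
  proof
    assume "p divides c"
    then obtain t where t: "t \<in> carrier R" "c = p \<otimes> t"
      by (auto simp: factor_def)
    then have "p \<otimes> (q \<otimes> t) = p \<otimes> \<one>"
      using c assms by (simp add: m_ac)
    then have "q \<otimes> t = \<one>"
      using m_lcancel[of p "q \<otimes> t" \<one>] assms(1,3,4) t(1) m_closed one_closed
      unfolding ring_prime_def by blast
    then have "q \<in> Units R"
      using assms t unfolding Units_def by (auto simp: m_comm intro!: bexI[of _ t])
    then show False
      using assms by (simp add: ring_prime_def prime_def)
  qed
  moreover have "p divides q \<or> p divides c"
  proof -
    have "p divides q \<otimes> c"
      using c(2) divides_refl[OF assms(3)] by simp
    then show ?thesis
      using assms c(1) unfolding ring_prime_def prime_def by blast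
  qed
  ultimately show ?thesis
    using assms by (simp add: associated_def)
qed

text \<open>Read in R/(d): the class of \<open>b\<close> is killed by p^(e+1) but not by p^e, with
  \<open>e\<close> one below the exponent of the theorem. If q does not divide p, then d is prime to
  p^(e+1) and so divides b, which is absurd; thus d is p^n up to a unit, and n \<le> e would make
  p^e kill everything. If p divided b, then p^e would already kill the class of b.\<close>

lemma (in domain) prime_power_annihilates_exactly:
  assumes p: "ring_prime p" "p \<in> carrier R"
    and q: "ring_prime q" "q \<in> carrier R" and d: "d \<in> carrier R" "power_upto_unit R q d"
    and b: "b \<in> carrier R" "d divides p [^] Suc e \<otimes> b" "\<not> d divides p [^] e \<otimes> b"
    and max: "\<And>m. d \<sim> p [^] m \<Longrightarrow> m \<le> Suc e"
  shows "d \<sim> p [^] Suc e" "\<not> p divides b"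
proof -
  obtain n :: nat where n: "n \<ge> 1" "d \<sim> q [^] n"
    using d by (auto simp: power_upto_unit_def)
  have "q divides p"
  proof (rule ccontr)
    assume "\<not> q divides p"
    then have "\<not> q divides p [^] Suc e"
      using prime_divides_nat_pow[of q p "Suc e"] p q unfolding ring_prime_def by blast
    moreover have "q [^] n divides p [^] Suc e \<otimes> b"
      using divides_trans[OF associatedD[OF associated_sym[OF n(2)]] b(2)] q by simp
    ultimately have "q [^] n divides b"
      by (rule prime_power_divides_cancel[OF q nat_pow_closed[OF p(2)] _ b(1)])
    then have "d divides b"
      by (rule divides_trans[OF associatedD[OF n(2)] _ d(1)])
    then have "d divides p [^] e \<otimes> b"
      by (rule divides_prod_l[OF d(1) b(1) nat_pow_closed[OF p(2)]])
    with b show False by blast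
  qed
  then have "p \<sim> q"
    by (intro primes_associated p q)
  then have "q [^] n \<sim> p [^] n"
    using p q by (auto simp: associated_def intro: divides_nat_pow)
  then have dn: "d \<sim> p [^] n"
    by (rule associated_trans[OF n(2) _ d(1) nat_pow_closed[OF p(2)]])
  have "n = Suc e"
  proof (rule ccontr)
    assume "n \<noteq> Suc e"
    then have "n \<le> e"
      using max[OF dn] by simp
    then have "p [^] n divides p [^] e"
      using p by (intro nat_pow_divides_nat_pow)
    then have "d divides p [^] e"
      by (rule divides_trans[OF associatedD[OF dn] _ d(1)])
    then have "d divides p [^] e \<otimes> b"
      by (rule divides_prod_r[OF _ d(1) b(1)])
    with b show False by blast
  qed
  with dn show de: "d \<sim> p [^] Suc e" by simp
  show "\<not> p divides b"
  proof
    assume "p divides b"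
    then obtain t where t: "t \<in> carrier R" "b = p \<otimes> t"
      by (auto simp: factor_def)
    have "p [^] Suc e divides p [^] e \<otimes> b"
      using t p by (auto simp: factor_def m_ac intro!: bexI[of _ t])
    then have "d divides p [^] e \<otimes> b"
      by (rule divides_trans[OF associatedD[OF de] _ d(1)])
    with b show False by blast
  qed
qed

text \<open>The ideal generated by p and b has a generator g with p = g h. Since g divides b, p does
  not divide g; so p divides h, and cancelling p makes g a unit. This settles the first power;
  induction gives the others.\<close>

lemma (in principal_domain) prime_power_bezout:
  assumes p: "ring_prime p" "p \<in> carrier R" and b: "b \<in> carrier R" "\<not> p divides b"
  shows "\<exists>c\<in>carrier R. \<exists>s\<in>carrier R. c \<otimes> b \<oplus> s \<otimes> p [^] (n::nat) = \<one>"
proof -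
  obtain g where g: "g \<in> carrier R" "PIdl p <+>\<^bsub>R\<^esub> PIdl b = PIdl g"
    using exists_gen[OF add_ideals[OF cgenideal_ideal cgenideal_ideal]] p b by blast
  have sum: "x \<in> PIdl g \<longleftrightarrow> (\<exists>s\<in>carrier R. \<exists>c\<in>carrier R. x = s \<otimes> p \<oplus> c \<otimes> b)" for x
    unfolding g(2)[symmetric] by (auto simp: set_add_def' cgenideal_def)
  have "p \<in> PIdl g"
    unfolding sum using p b by (intro bexI[of _ \<one>] bexI[of _ \<zero>]) auto
  then obtain h where h: "h \<in> carrier R" "p = g \<otimes> h"
    using g by (auto simp: mem_PIdl_iff factor_def)
  have "b \<in> PIdl g"
    unfolding sum using p b by (intro bexI[of _ \<zero>] bexI[of _ \<one>]) auto
  then have "g divides b"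
    using g by (simp add: mem_PIdl_iff)
  have "\<not> p divides g"
    using \<open>g divides b\<close> b p g divides_trans by blast
  moreover have "p divides g \<or> p divides h"
  proof -
    have "p divides g \<otimes> h"
      using h(2) divides_refl[OF p(2)] by simp
    then show ?thesis
      using p g(1) h(1) unfolding ring_prime_def prime_def by blast
  qed
  ultimately obtain t where t: "t \<in> carrier R" "h = p \<otimes> t"
    by (auto simp: factor_def)
  then have "p \<otimes> (g \<otimes> t) = p \<otimes> \<one>"
    using h p g by (simp add: m_ac)
  then have "g \<otimes> t = \<one>"
    using m_lcancel[of p "g \<otimes> t" \<one>] p g(1) t(1) m_closed one_closed
    unfolding ring_prime_def by blast
  then have "\<one> \<in> PIdl g"
    using g t by (auto simp: mem_PIdl_iff factor_def intro!: bexI[of _ t])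
  then obtain s c where sc: "s \<in> carrier R" "c \<in> carrier R" "\<one> = s \<otimes> p \<oplus> c \<otimes> b"
    unfolding sum by blast
  show ?thesis
  proof (induction n)
    case 0
    show ?case
      using b by (intro bexI[of _ \<zero>] bexI[of _ \<one>]) auto
  next
    case (Suc n)
    then obtain c' s' where c': "c' \<in> carrier R" "s' \<in> carrier R"
      "c' \<otimes> b \<oplus> s' \<otimes> p [^] n = \<one>" by blast
    \<comment> \<open>The relation for the first power is inserted only into the summand with p^n:
      its p-part raises the exponent, and its b-part is absorbed into the coefficient of
      \<open>b\<close>.\<close>
    have "\<one> = c' \<otimes> b \<oplus> s' \<otimes> p [^] n \<otimes> (s \<otimes> p \<oplus> c \<otimes> b)"
      using c' p sc(3)[symmetric] by simp
    also have "\<dots> = (c' \<oplus> s' \<otimes> p [^] n \<otimes> c) \<otimes> b \<oplus> (s' \<otimes> s) \<otimes> p [^] Suc n"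
      using c' sc(1,2) p b by (simp add: l_distr r_distr a_ac m_ac)
    finally show ?case
      using c' sc(1,2) p by (metis a_closed m_closed nat_pow_closed)
  qed
qed

text \<open>Otherwise p^(n+1) divides p^n, and cancelling p^n makes p a unit. It allows exponents to
  be compared although elementary divisors are known only up to units.\<close>

lemma (in domain) prime_nat_pow_divides_imp_le:
  assumes "ring_prime p" "p \<in> carrier R" "p [^] (m::nat) divides p [^] (n::nat)"
  shows "m \<le> n"
proof (rule ccontr)
  assume "\<not> m \<le> n"
  then have "p [^] Suc n divides p [^] m"
    by (intro nat_pow_divides_nat_pow assms) simp
  then have "p [^] Suc n divides p [^] n"
    using assms by (meson divides_trans nat_pow_closed)
  then have "p [^] n \<otimes> p divides p [^] n \<otimes> \<one>"
    using assms by simp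
  moreover have "p [^] n \<in> carrier R - {\<zero>}"
    using assms(1,2) nat_pow_nonzero[of p n] by (auto simp: ring_prime_def)
  ultimately have "p divides \<one>"
    using assms by (intro mult_divides[of p \<one> "p [^] n"]) auto
  then show False
    using assms divides_one by (auto simp: ring_prime_def prime_def)
qed

text \<open>Since p^e w is not zero, some coordinate of it is not zero; that index is
  \<open>j\<close>. A representative \<open>b\<close> of the coordinate is prime to p, hence
  invertible modulo p^(e+1). Invertibility gives both conclusions about \<open>w j\<close>: it
  generates the summand, and its annihilator is no larger than (p^(e+1)).\<close>

lemma (in principal_domain) direct_sum_cyclic_component:
  fixes ds :: "'a list"
  defines "D \<equiv> finite_direct_sum {..<length ds} (\<lambda>i. cyclic_module R (ds ! i))"
  assumes ds: "\<And>d. d \<in> set ds \<Longrightarrow>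
      d \<in> carrier R \<and> (\<exists>q\<in>carrier R. ring_prime q \<and> power_upto_unit R q d)"
    and p: "ring_prime p" "p \<in> carrier R"
    and max: "\<And>d m. d \<in> set ds \<Longrightarrow> d \<sim> p [^] m \<Longrightarrow> m \<le> Suc e"
    and w: "w \<in> carrier D" "p [^] Suc e \<odot>\<^bsub>D\<^esub> w = \<zero>\<^bsub>D\<^esub>" "p [^] e \<odot>\<^bsub>D\<^esub> w \<noteq> \<zero>\<^bsub>D\<^esub>"
  obtains j where "j < length ds" "ds ! j \<sim> p [^] Suc e"
    and "\<And>z. z \<in> carrier (cyclic_module R (ds ! j)) \<Longrightarrow>
      \<exists>r\<in>carrier R. z = r \<odot>\<^bsub>cyclic_module R (ds ! j)\<^esub> w j"
    and "\<And>r. r \<in> carrier R \<Longrightarrow> r \<odot>\<^bsub>cyclic_module R (ds ! j)\<^esub> w j = \<zero>\<^bsub>cyclic_module R (ds ! j)\<^esub> \<Longrightarrow>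
      p [^] Suc e divides r"
proof -
  note Ds = finite_direct_sum_simps[where I="{..<length ds}" and N="\<lambda>i. cyclic_module R (ds ! i)",
      folded D_def]
  have "\<exists>j<length ds. p [^] e \<odot>\<^bsub>cyclic_module R (ds ! j)\<^esub> w j \<noteq> \<zero>\<^bsub>cyclic_module R (ds ! j)\<^esub>"
  proof (rule ccontr)
    assume "\<not> ?thesis"
    then have "p [^] e \<odot>\<^bsub>D\<^esub> w = \<zero>\<^bsub>D\<^esub>"
      by (auto simp: Ds intro!: restrict_ext)
    with w show False by blast
  qed
  then obtain j where j: "j < length ds"
    "p [^] e \<odot>\<^bsub>cyclic_module R (ds ! j)\<^esub> w j \<noteq> \<zero>\<^bsub>cyclic_module R (ds ! j)\<^esub>" by blast
  have w0: "p [^] Suc e \<odot>\<^bsub>cyclic_module R (ds ! j)\<^esub> w j = \<zero>\<^bsub>cyclic_module R (ds ! j)\<^esub>"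
    using fun_cong[OF w(2), of j] j by (simp add: Ds del: nat_pow_Suc)
  let ?d = "ds ! j" and ?c = "\<lambda>b. PIdl (ds ! j) +>\<^bsub>ring_as_module R\<^esub> b"
  have dj: "?d \<in> set ds" using j by simp
  have d: "?d \<in> carrier R"
    using ds[OF dj] by blast
  obtain q where q: "q \<in> carrier R" "ring_prime q" "power_upto_unit R q ?d"
    using ds[OF dj] by blast
  have "w j \<in> carrier (cyclic_module R ?d)"
    using w(1) j by (auto simp: Ds)
  then obtain b where b: "b \<in> carrier R" "w j = ?c b"
    by (auto simp: carrier_cyclic_module)
  have smult: "r \<odot>\<^bsub>cyclic_module R ?d\<^esub> w j = ?c (r \<otimes> b)" if "r \<in> carrier R" for r
    using that b d by (simp add: smult_cyclic_module)
  have zero: "r \<odot>\<^bsub>cyclic_module R ?d\<^esub> w j = \<zero>\<^bsub>cyclic_module R ?d\<^esub> \<longleftrightarrow> ?d divides r \<otimes> b"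
    if "r \<in> carrier R" for r
    unfolding smult[OF that] using that b d by (intro cyclic_module_eq_zero_iff) simp_all
  have de: "?d \<sim> p [^] Suc e" and pb: "\<not> p divides b"
    using prime_power_annihilates_exactly[OF p q(2,1) d q(3) b(1), of e] max[OF dj] j(2) w0 p zero
    by (simp_all del: nat_pow_Suc)
  obtain c s where cs: "c \<in> carrier R" "s \<in> carrier R" "c \<otimes> b \<oplus> s \<otimes> p [^] Suc e = \<one>"
    using prime_power_bezout[OF p b(1) pb] by blast
  have dvd_iff: "?d divides x \<longleftrightarrow> p [^] Suc e divides x" if "x \<in> carrier R" for x
    using divides_trans[OF associatedD[OF de]] divides_trans[OF associatedD[OF associated_sym[OF de]]] d
      nat_pow_closed[OF p(2)] by blast
  show thesis
  proof (rule that[OF j(1) de])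
    fix z assume "z \<in> carrier (cyclic_module R ?d)"
    then obtain t where t: "t \<in> carrier R" "z = ?c t"
      by (auto simp: carrier_cyclic_module)
    \<comment> \<open>As \<open>c\<close> inverts \<open>b\<close> modulo p^(e+1), the class of
      \<open>t\<close> is \<open>t \<otimes> c\<close> times the class of \<open>b\<close>.\<close>
    have "t \<ominus> t \<otimes> c \<otimes> b = t \<otimes> (c \<otimes> b \<oplus> s \<otimes> p [^] Suc e) \<ominus> t \<otimes> c \<otimes> b"
      using t by (simp only: cs(3) r_one)
    also have "\<dots> = (t \<otimes> s) \<otimes> p [^] Suc e"
      using t cs(1,2) b p nat_pow_closed[OF p(2), of "Suc e"]
      by (simp add: r_distr m_assoc a_minus_def a_ac r_neg1 r_neg2 r_neg del: nat_pow_Suc)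
    finally have "?d divides (t \<ominus> t \<otimes> c \<otimes> b)"
      using t cs(1,2) p by (simp add: dvd_iff divides_prod_l del: nat_pow_Suc)
    then have "?c t = ?c ((t \<otimes> c) \<otimes> b)"
      using module.coset_eq_iff[OF ring_as_module_is_module PIdl_submodule[OF d], of t "(t \<otimes> c) \<otimes> b"]
        t cs(1) b d by (simp add: mem_PIdl_iff) (simp add: ring_as_module_def a_minus_def a_inv_def m_inv_def)
    then show "\<exists>r\<in>carrier R. z = r \<odot>\<^bsub>cyclic_module R ?d\<^esub> w j"
      using t cs(1) by (intro bexI[of _ "t \<otimes> c"]) (simp_all add: smult)
  next
    fix r assume r: "r \<in> carrier R" "r \<odot>\<^bsub>cyclic_module R ?d\<^esub> w j = \<zero>\<^bsub>cyclic_module R ?d\<^esub>"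
    then have "p [^] Suc e divides r \<otimes> b"
      using zero[of r] dvd_iff[of "r \<otimes> b"] b(1) m_closed[of r b] by blast
    then obtain t where t: "t \<in> carrier R" "r \<otimes> b = p [^] Suc e \<otimes> t"
      by (auto simp: factor_def simp del: nat_pow_Suc)
    have pc: "p [^] Suc e \<in> carrier R" using p by blast
    \<comment> \<open>The same inverse recovers \<open>r\<close> from \<open>r \<otimes> b\<close>
      modulo p^(e+1).\<close>
    have "r = r \<otimes> (c \<otimes> b \<oplus> s \<otimes> p [^] Suc e)"
      using r by (simp only: cs(3) r_one)
    also have "\<dots> = c \<otimes> (r \<otimes> b) \<oplus> p [^] Suc e \<otimes> (r \<otimes> s)"
      using r(1) cs(1,2) b pc by (simp add: r_distr m_ac del: nat_pow_Suc)
    also have "\<dots> = p [^] Suc e \<otimes> (c \<otimes> t \<oplus> r \<otimes> s)"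
      unfolding t(2) using r(1) cs(1,2) t(1) pc by (simp add: r_distr m_ac del: nat_pow_Suc)
    finally show "p [^] Suc e divides r"
      using r(1) cs(1,2) t(1) by (intro dividesI[of "c \<otimes> t \<oplus> r \<otimes> s"]) auto
  qed
qed

section \<open>Bases and adjunction of a vector\<close>

context module
begin

lemma finsum_split_off:
  assumes "finite I" "i \<in> I" "f \<in> I \<rightarrow> carrier M"
  shows "(\<Oplus>\<^bsub>M\<^esub>j\<in>I. f j) = f i \<oplus>\<^bsub>M\<^esub> (\<Oplus>\<^bsub>M\<^esub>j\<in>I - {i}. f j)"
proof -
  have "(\<Oplus>\<^bsub>M\<^esub>j\<in>insert i (I - {i}). f j) = f i \<oplus>\<^bsub>M\<^esub> (\<Oplus>\<^bsub>M\<^esub>j\<in>I - {i}. f j)"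
    using assms by (intro M.finsum_insert) auto
  then show ?thesis
    using assms by (simp add: insert_absorb)
qed

text \<open>A repeated vector gives the relation with coefficients 1 and -1 at its two indices. Thus
  independence stated with indexed coefficients already contains the injectivity that
  \<open>basis_family\<close> demands.\<close>

lemma family_independent_imp_inj_on:
  assumes "finite I" "u \<in> I \<rightarrow> carrier M" "\<one>\<^bsub>R\<^esub> \<noteq> \<zero>\<^bsub>R\<^esub>"
    and "\<And>a. a \<in> I \<rightarrow> carrier R \<Longrightarrow> (\<Oplus>\<^bsub>M\<^esub>i\<in>I. a i \<odot>\<^bsub>M\<^esub> u i) = \<zero>\<^bsub>M\<^esub> \<Longrightarrow> \<forall>i\<in>I. a i = \<zero>\<^bsub>R\<^esub>"
  shows "inj_on u I"
proof (rule inj_onI, rule ccontr)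
  fix i j assume ij: "i \<in> I" "j \<in> I" "u i = u j" "i \<noteq> j"
  define a where "a k = (if k = i then \<one>\<^bsub>R\<^esub> else if k = j then \<ominus>\<^bsub>R\<^esub> \<one>\<^bsub>R\<^esub> else \<zero>\<^bsub>R\<^esub>)" for k
  have a: "a \<in> I \<rightarrow> carrier R"
    by (auto simp: a_def)
  have a1: "a i = \<one>\<^bsub>R\<^esub>" "a j = \<ominus>\<^bsub>R\<^esub> \<one>\<^bsub>R\<^esub>"
    using ij by (auto simp: a_def)
  have uc: "u k \<in> carrier M" if "k \<in> I" for k
    using assms(2) that by blast
  have "(\<Oplus>\<^bsub>M\<^esub>k\<in>I - {i} - {j}. a k \<odot>\<^bsub>M\<^esub> u k) = \<zero>\<^bsub>M\<^esub>"
    by (rule finsum_all0) (auto simp: a_def uc)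
  moreover have "(\<Oplus>\<^bsub>M\<^esub>k\<in>I - {i}. a k \<odot>\<^bsub>M\<^esub> u k) =
      a j \<odot>\<^bsub>M\<^esub> u j \<oplus>\<^bsub>M\<^esub> (\<Oplus>\<^bsub>M\<^esub>k\<in>I - {i} - {j}. a k \<odot>\<^bsub>M\<^esub> u k)"
    by (rule finsum_split_off) (use assms(1) ij a uc in auto)
  moreover have "(\<Oplus>\<^bsub>M\<^esub>k\<in>I. a k \<odot>\<^bsub>M\<^esub> u k) =
      a i \<odot>\<^bsub>M\<^esub> u i \<oplus>\<^bsub>M\<^esub> (\<Oplus>\<^bsub>M\<^esub>k\<in>I - {i}. a k \<odot>\<^bsub>M\<^esub> u k)"
    by (rule finsum_split_off) (use assms(1) ij a uc in auto)
  ultimately have "(\<Oplus>\<^bsub>M\<^esub>k\<in>I. a k \<odot>\<^bsub>M\<^esub> u k) = \<zero>\<^bsub>M\<^esub>"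
    using ij uc[of j] a1 by (simp add: smult_l_minus M.r_neg)
  then have "a i = \<zero>\<^bsub>R\<^esub>"
    using assms(4)[OF a] ij by blast
  then show False
    using assms(3) by (simp add: a_def)
qed

lemma lincomb_image_eq:
  assumes "inj_on u I" "u \<in> I \<rightarrow> carrier M" "b \<in> u ` I \<rightarrow> carrier R"
  shows "lincomb b (u ` I) = (\<Oplus>\<^bsub>M\<^esub>i\<in>I. b (u i) \<odot>\<^bsub>M\<^esub> u i)"
  unfolding lincomb_def using assms by (intro M.finsum_reindex) auto

lemma lincomb_inv_into_eq:
  assumes "inj_on u I" "u \<in> I \<rightarrow> carrier M" "a \<in> I \<rightarrow> carrier R"
  shows "lincomb (\<lambda>x. a (inv_into I u x)) (u ` I) = (\<Oplus>\<^bsub>M\<^esub>i\<in>I. a i \<odot>\<^bsub>M\<^esub> u i)"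
  using assms by (subst lincomb_image_eq) (auto intro!: M.finsum_cong')

text \<open>\<open>basis_family\<close> speaks of span and independence of the set of vectors inside
  the submodule record. The right-hand side uses coefficients attached to indices and sums in the
  ambient module, the form in which coefficients can be changed one at a time. Injectivity of
  \<open>u\<close> justifies passing between the two.\<close>

lemma basis_family_submodule_iff:
  assumes N: "submodule R N M" and I: "finite I" and one: "\<one>\<^bsub>R\<^esub> \<noteq> \<zero>\<^bsub>R\<^esub>"
  shows "basis_family R (M\<lparr>carrier := N\<rparr>) I u \<longleftrightarrow> u \<in> I \<rightarrow> N \<and>
    (\<forall>a\<in>I \<rightarrow> carrier R. (\<Oplus>\<^bsub>M\<^esub>i\<in>I. a i \<odot>\<^bsub>M\<^esub> u i) = \<zero>\<^bsub>M\<^esub> \<longrightarrow> (\<forall>i\<in>I. a i = \<zero>\<^bsub>R\<^esub>)) \<and>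
    (\<forall>x\<in>N. \<exists>a\<in>I \<rightarrow> carrier R. x = (\<Oplus>\<^bsub>M\<^esub>i\<in>I. a i \<odot>\<^bsub>M\<^esub> u i))"
    (is "?B \<longleftrightarrow> ?U \<and> ?indep \<and> ?gen")
proof (cases "?U \<and> inj_on u I")
  case True
  then have U: "u \<in> I \<rightarrow> carrier M" "u ` I \<subseteq> carrier M" "u ` I \<subseteq> N"
    and inj: "inj_on u I"
    using submodule.subset[OF N] by auto
  have fin: "finite (u ` I)" using I by simp
  have inv: "(\<lambda>x. a (inv_into I u x)) \<in> u ` I \<rightarrow> carrier R" if "a \<in> I \<rightarrow> carrier R" for a
    using that inj by auto
  have comp: "(\<lambda>i. b (u i)) \<in> I \<rightarrow> carrier R" if "b \<in> u ` I \<rightarrow> carrier R" for b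
    using that by auto
  have "lin_indpt (u ` I) \<longleftrightarrow> ?indep"
  proof
    assume li: "lin_indpt (u ` I)"
    show ?indep
    proof (intro ballI impI)
      fix a i assume a: "a \<in> I \<rightarrow> carrier R" "(\<Oplus>\<^bsub>M\<^esub>i\<in>I. a i \<odot>\<^bsub>M\<^esub> u i) = \<zero>\<^bsub>M\<^esub>" "i \<in> I"
      then show "a i = \<zero>\<^bsub>R\<^esub>"
        using li lin_dep_crit[OF fin subset_refl inv[OF a(1)], of "u i"] inj
          lincomb_inv_into_eq[OF inj U(1) a(1)] by auto
    qed
  next
    assume indep: ?indep
    show "lin_indpt (u ` I)"
    proof (rule finite_lin_indpt2[OF fin U(2)])
      fix b assume b: "b \<in> u ` I \<rightarrow> carrier R" "lincomb b (u ` I) = \<zero>\<^bsub>M\<^esub>"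
      have "(\<Oplus>\<^bsub>M\<^esub>i\<in>I. b (u i) \<odot>\<^bsub>M\<^esub> u i) = \<zero>\<^bsub>M\<^esub>"
        using b(2) unfolding lincomb_image_eq[OF inj U(1) b(1)] .
      then have "\<forall>i\<in>I. b (u i) = \<zero>\<^bsub>R\<^esub>"
        by (rule mp[OF bspec[OF indep comp[OF b(1)]]])
      then show "\<forall>x\<in>u ` I. b x = \<zero>\<^bsub>R\<^esub>" by blast
    qed
  qed
  moreover have "span (u ` I) = N \<longleftrightarrow> ?gen"
  proof -
    have "span (u ` I) = {\<Oplus>\<^bsub>M\<^esub>i\<in>I. a i \<odot>\<^bsub>M\<^esub> u i | a. a \<in> I \<rightarrow> carrier R}"
      unfolding finite_span[OF fin U(2)]
    proof (intro equalityI subsetI)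
      fix z assume "z \<in> {lincomb b (u ` I) | b. b \<in> u ` I \<rightarrow> carrier R}"
      then obtain b where "z = lincomb b (u ` I)" "b \<in> u ` I \<rightarrow> carrier R" by blast
      then show "z \<in> {\<Oplus>\<^bsub>M\<^esub>i\<in>I. a i \<odot>\<^bsub>M\<^esub> u i | a. a \<in> I \<rightarrow> carrier R}"
        using comp[of b] lincomb_image_eq[OF inj U(1), of b]
        by (intro CollectI exI[of _ "\<lambda>i. b (u i)"]) simp
    next
      fix z assume "z \<in> {\<Oplus>\<^bsub>M\<^esub>i\<in>I. a i \<odot>\<^bsub>M\<^esub> u i | a. a \<in> I \<rightarrow> carrier R}"
      then obtain a where "z = (\<Oplus>\<^bsub>M\<^esub>i\<in>I. a i \<odot>\<^bsub>M\<^esub> u i)" "a \<in> I \<rightarrow> carrier R" by blast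
      then show "z \<in> {lincomb b (u ` I) | b. b \<in> u ` I \<rightarrow> carrier R}"
        using inv[of a] lincomb_inv_into_eq[OF inj U(1), of a]
        by (intro CollectI exI[of _ "\<lambda>x. a (inv_into I u x)"]) simp
    qed
    then show ?thesis
      using span_is_subset[OF U(3) N] by blast
  qed
  ultimately show ?thesis
    using True U by (auto simp: basis_family_def span_li_not_depend[OF U(3) N])
next
  \<comment> \<open>Both sides fail here, since each implies membership in \<open>N\<close> and
    injectivity; on the right, injectivity follows from independence.\<close>
  case False
  show ?thesis
  proof -
    note False
    moreover have "?U" "inj_on u I" if ?B
      using that by (auto simp: basis_family_def)
    moreover have "inj_on u I" if ?U ?indep
      using that submodule.subset[OF N]
      by (intro family_independent_imp_inj_on[OF I _ one]) auto
    ultimately show ?thesis by blast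
  qed
qed

section \<open>The submodule Rv + N and its basis\<close>

lemma mem_adjoin_iff: "z \<in> adjoin R M v N \<longleftrightarrow> (\<exists>r\<in>carrier R. \<exists>n\<in>N. z = r \<odot>\<^bsub>M\<^esub> v \<oplus>\<^bsub>M\<^esub> n)"
  by (auto simp: adjoin_def set_add_def')

lemma adjoin_submodule:
  assumes "submodule R N M" "v \<in> carrier M"
  shows "submodule R (adjoin R M v N) M"
proof -
  interpret N: submodule R N M by fact
  note Nc = subsetD[OF N.subset]
  show ?thesis
  proof (rule submodule.intro, rule module_axioms)
    show "adjoin R M v N \<subseteq> carrier M"
      using assms(2) Nc by (auto simp: mem_adjoin_iff)
    show "\<zero>\<^bsub>M\<^esub> \<in> adjoin R M v N"
      unfolding mem_adjoin_iff using assms(2)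
      by (intro bexI[of _ "\<zero>\<^bsub>R\<^esub>"] bexI[of _ "\<zero>\<^bsub>M\<^esub>"]) auto
  next
    fix x y assume "x \<in> adjoin R M v N" "y \<in> adjoin R M v N"
    then obtain r m s n where *: "r \<in> carrier R" "s \<in> carrier R" "m \<in> N" "n \<in> N"
      "x = r \<odot>\<^bsub>M\<^esub> v \<oplus>\<^bsub>M\<^esub> m" "y = s \<odot>\<^bsub>M\<^esub> v \<oplus>\<^bsub>M\<^esub> n"
      by (auto simp: mem_adjoin_iff)
    then have "x \<oplus>\<^bsub>M\<^esub> y = (r \<oplus>\<^bsub>R\<^esub> s) \<odot>\<^bsub>M\<^esub> v \<oplus>\<^bsub>M\<^esub> (m \<oplus>\<^bsub>M\<^esub> n)"
      using assms(2) Nc by (simp add: smult_l_distr M.a_ac)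
    then show "x \<oplus>\<^bsub>M\<^esub> y \<in> adjoin R M v N"
      using * by (auto simp: mem_adjoin_iff)
  next
    fix c x assume c: "c \<in> carrier R" "x \<in> adjoin R M v N"
    then obtain r m where *: "r \<in> carrier R" "m \<in> N" "x = r \<odot>\<^bsub>M\<^esub> v \<oplus>\<^bsub>M\<^esub> m"
      by (auto simp: mem_adjoin_iff)
    then have "c \<odot>\<^bsub>M\<^esub> x = (c \<otimes>\<^bsub>R\<^esub> r) \<odot>\<^bsub>M\<^esub> v \<oplus>\<^bsub>M\<^esub> c \<odot>\<^bsub>M\<^esub> m"
      using assms(2) Nc c by (simp add: smult_r_distr smult_assoc1)
    then show "c \<odot>\<^bsub>M\<^esub> x \<in> adjoin R M v N"
      using * c by (auto simp: mem_adjoin_iff)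
  qed
qed

text \<open>Modulo the \<open>u j\<close> with \<open>j \<noteq> i\<close>, the hypothesis says q v
  = a_i u_i, so v and u_i behave like a_i and q times one common vector. The Bezout combination
  \<open>v'\<close> is that vector: modulo the same \<open>u j\<close>, v = a_i v' and u_i = q v'.
  In the application \<open>q\<close> is p^e.\<close>

lemma basis_family_adjoin:
  assumes N: "submodule R N M" and I: "finite I" and one: "\<one>\<^bsub>R\<^esub> \<noteq> \<zero>\<^bsub>R\<^esub>"
    and u: "basis_family R (M\<lparr>carrier := N\<rparr>) I u" and i: "i \<in> I"
    and v: "v \<in> carrier M" and q: "q \<in> carrier R" and a: "a \<in> I \<rightarrow> carrier R"
    and qv: "q \<odot>\<^bsub>M\<^esub> v = (\<Oplus>\<^bsub>M\<^esub>j\<in>I. a j \<odot>\<^bsub>M\<^esub> u j)"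
    and x: "x \<in> carrier R" and y: "y \<in> carrier R" and xy: "x \<otimes>\<^bsub>R\<^esub> a i \<oplus>\<^bsub>R\<^esub> y \<otimes>\<^bsub>R\<^esub> q = \<one>\<^bsub>R\<^esub>"
  shows "basis_family R (M\<lparr>carrier := adjoin R M v N\<rparr>) I (u(i := x \<odot>\<^bsub>M\<^esub> v \<oplus>\<^bsub>M\<^esub> y \<odot>\<^bsub>M\<^esub> u i))"
proof -
  have uN: "u \<in> I \<rightarrow> N"
    and indep: "\<And>c. c \<in> I \<rightarrow> carrier R \<Longrightarrow> (\<Oplus>\<^bsub>M\<^esub>j\<in>I. c j \<odot>\<^bsub>M\<^esub> u j) = \<zero>\<^bsub>M\<^esub> \<Longrightarrow> \<forall>j\<in>I. c j = \<zero>\<^bsub>R\<^esub>"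
    and gen: "\<And>z. z \<in> N \<Longrightarrow> \<exists>c\<in>I \<rightarrow> carrier R. z = (\<Oplus>\<^bsub>M\<^esub>j\<in>I. c j \<odot>\<^bsub>M\<^esub> u j)"
    using u unfolding basis_family_submodule_iff[OF N I one] by blast+
  have uc: "u j \<in> carrier M" if "j \<in> I" for j
    using uN that submodule.subset[OF N] by blast
  \<comment> \<open>The part of a combination that the old and the new family share; they differ
    only in the term at \<open>i\<close>.\<close>
  define S where "S c = (\<Oplus>\<^bsub>M\<^esub>j\<in>I - {i}. c j \<odot>\<^bsub>M\<^esub> u j)" for c
  have Sc [simp]: "S c \<in> carrier M" if "c \<in> I \<rightarrow> carrier R" for c
    unfolding S_def using that uc by (intro M.finsum_closed) auto
  have S_add: "S c \<oplus>\<^bsub>M\<^esub> S d = S (\<lambda>j. c j \<oplus>\<^bsub>R\<^esub> d j)"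
    if "c \<in> I \<rightarrow> carrier R" "d \<in> I \<rightarrow> carrier R" for c d
  proof -
    have "S c \<oplus>\<^bsub>M\<^esub> S d = (\<Oplus>\<^bsub>M\<^esub>j\<in>I - {i}. c j \<odot>\<^bsub>M\<^esub> u j \<oplus>\<^bsub>M\<^esub> d j \<odot>\<^bsub>M\<^esub> u j)"
      unfolding S_def using that uc by (intro M.finsum_addf[symmetric]) auto
    also have "\<dots> = S (\<lambda>j. c j \<oplus>\<^bsub>R\<^esub> d j)"
      unfolding S_def using that uc
      by (intro M.finsum_cong') (auto simp: Pi_iff smult_l_distr)
    finally show ?thesis .
  qed
  have S_smult: "r \<odot>\<^bsub>M\<^esub> S c = S (\<lambda>j. r \<otimes>\<^bsub>R\<^esub> c j)"
    if "r \<in> carrier R" "c \<in> I \<rightarrow> carrier R" for r c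
  proof -
    have "r \<odot>\<^bsub>M\<^esub> S c = (\<Oplus>\<^bsub>M\<^esub>j\<in>I - {i}. r \<odot>\<^bsub>M\<^esub> (c j \<odot>\<^bsub>M\<^esub> u j))"
      unfolding S_def using that uc by (intro finsum_smult) auto
    also have "\<dots> = S (\<lambda>j. r \<otimes>\<^bsub>R\<^esub> c j)"
      unfolding S_def using that uc
      by (intro M.finsum_cong') (auto simp: Pi_iff smult_assoc1)
    finally show ?thesis .
  qed
  have sum_u: "(\<Oplus>\<^bsub>M\<^esub>j\<in>I. c j \<odot>\<^bsub>M\<^esub> u j) = c i \<odot>\<^bsub>M\<^esub> u i \<oplus>\<^bsub>M\<^esub> S c"
    if "c \<in> I \<rightarrow> carrier R" for c
    unfolding S_def using that uc I i by (intro finsum_split_off) auto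
  have sum_upd: "(\<Oplus>\<^bsub>M\<^esub>j\<in>I. (if j = i then r else c j) \<odot>\<^bsub>M\<^esub> u j) = r \<odot>\<^bsub>M\<^esub> u i \<oplus>\<^bsub>M\<^esub> S c"
    if "r \<in> carrier R" "c \<in> I \<rightarrow> carrier R" for r c
  proof -
    have "S (\<lambda>j. if j = i then r else c j) = S c"
      unfolding S_def using that uc by (intro M.finsum_cong') auto
    moreover have "(\<lambda>j. if j = i then r else c j) \<in> I \<rightarrow> carrier R"
      using that by auto
    ultimately show ?thesis
      using sum_u[of "\<lambda>j. if j = i then r else c j"] by simp
  qed

  define v' where "v' = x \<odot>\<^bsub>M\<^esub> v \<oplus>\<^bsub>M\<^esub> y \<odot>\<^bsub>M\<^esub> u i"
  have v': "v' \<in> carrier M"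
    using v x y uc[OF i] by (simp add: v'_def)
  have sum_u': "(\<Oplus>\<^bsub>M\<^esub>j\<in>I. c j \<odot>\<^bsub>M\<^esub> (u(i := v')) j) = c i \<odot>\<^bsub>M\<^esub> v' \<oplus>\<^bsub>M\<^esub> S c"
    if "c \<in> I \<rightarrow> carrier R" for c
  proof -
    have "(\<Oplus>\<^bsub>M\<^esub>j\<in>I. c j \<odot>\<^bsub>M\<^esub> (u(i := v')) j) =
        c i \<odot>\<^bsub>M\<^esub> (u(i := v')) i \<oplus>\<^bsub>M\<^esub> (\<Oplus>\<^bsub>M\<^esub>j\<in>I - {i}. c j \<odot>\<^bsub>M\<^esub> (u(i := v')) j)"
      using that uc I i v' by (intro finsum_split_off) auto
    also have "(\<Oplus>\<^bsub>M\<^esub>j\<in>I - {i}. c j \<odot>\<^bsub>M\<^esub> (u(i := v')) j) = S c"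
      unfolding S_def using that uc by (intro M.finsum_cong') auto
    finally show ?thesis by simp
  qed
  have ai: "a i \<in> carrier R" and ui: "u i \<in> carrier M"
    using a uc i by auto
  note simps = a x y q v ui ai v' smult_l_distr smult_r_distr
  have qv_eq: "q \<odot>\<^bsub>M\<^esub> v = a i \<odot>\<^bsub>M\<^esub> u i \<oplus>\<^bsub>M\<^esub> S a"
    using qv sum_u[OF a] by simp
  have qv': "q \<odot>\<^bsub>M\<^esub> v' = u i \<oplus>\<^bsub>M\<^esub> x \<odot>\<^bsub>M\<^esub> S a"
  proof -
    have "q \<odot>\<^bsub>M\<^esub> v' = x \<odot>\<^bsub>M\<^esub> (q \<odot>\<^bsub>M\<^esub> v) \<oplus>\<^bsub>M\<^esub> (y \<otimes>\<^bsub>R\<^esub> q) \<odot>\<^bsub>M\<^esub> u i"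
      unfolding v'_def by (simp add: simps smult_assoc1[symmetric] R.m_comm)
    also have "\<dots> = (x \<otimes>\<^bsub>R\<^esub> a i \<oplus>\<^bsub>R\<^esub> y \<otimes>\<^bsub>R\<^esub> q) \<odot>\<^bsub>M\<^esub> u i \<oplus>\<^bsub>M\<^esub> x \<odot>\<^bsub>M\<^esub> S a"
      unfolding qv_eq by (simp add: simps smult_assoc1 M.a_ac)
    finally show ?thesis
      by (simp add: xy ui)
  qed
  have v_eq: "v = a i \<odot>\<^bsub>M\<^esub> v' \<oplus>\<^bsub>M\<^esub> y \<odot>\<^bsub>M\<^esub> S a"
  proof -
    have "a i \<odot>\<^bsub>M\<^esub> v' \<oplus>\<^bsub>M\<^esub> y \<odot>\<^bsub>M\<^esub> S a =
        (x \<otimes>\<^bsub>R\<^esub> a i) \<odot>\<^bsub>M\<^esub> v \<oplus>\<^bsub>M\<^esub> y \<odot>\<^bsub>M\<^esub> (a i \<odot>\<^bsub>M\<^esub> u i \<oplus>\<^bsub>M\<^esub> S a)"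
      unfolding v'_def by (simp add: simps smult_assoc1[symmetric] R.m_comm M.a_ac)
    also have "\<dots> = (x \<otimes>\<^bsub>R\<^esub> a i \<oplus>\<^bsub>R\<^esub> y \<otimes>\<^bsub>R\<^esub> q) \<odot>\<^bsub>M\<^esub> v"
      unfolding qv_eq[symmetric] by (simp add: simps smult_assoc1)
    finally show ?thesis
      by (simp add: xy v)
  qed
  \<comment> \<open>With \<open>v_eq\<close>, this expresses the old generators in the new ones.\<close>
  have ui_eq: "u i = q \<odot>\<^bsub>M\<^esub> v' \<oplus>\<^bsub>M\<^esub> (\<ominus>\<^bsub>R\<^esub> x) \<odot>\<^bsub>M\<^esub> S a"
    unfolding qv' by (simp add: simps smult_l_minus M.a_assoc M.r_neg)

  have P: "submodule R (adjoin R M v N) M"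
    using N v by (rule adjoin_submodule)
  have NP: "N \<subseteq> adjoin R M v N"
  proof
    fix n assume "n \<in> N"
    then show "n \<in> adjoin R M v N"
      unfolding mem_adjoin_iff using v submodule.subset[OF N]
      by (intro bexI[of _ "\<zero>\<^bsub>R\<^esub>"] bexI[of _ n]) auto
  qed
  have "v' \<in> adjoin R M v N"
    unfolding mem_adjoin_iff v'_def
    using x y uN i submodule.smult_closed[OF N] by blast
  then have "u(i := v') \<in> I \<rightarrow> adjoin R M v N"
    using uN NP by auto
  moreover have "\<forall>j\<in>I. c j = \<zero>\<^bsub>R\<^esub>"
    if c: "c \<in> I \<rightarrow> carrier R" "(\<Oplus>\<^bsub>M\<^esub>j\<in>I. c j \<odot>\<^bsub>M\<^esub> (u(i := v')) j) = \<zero>\<^bsub>M\<^esub>" for c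
  proof -
    have ci: "c i \<in> carrier R" using c i by auto
    have zero: "c i \<odot>\<^bsub>M\<^esub> v' \<oplus>\<^bsub>M\<^esub> S c = \<zero>\<^bsub>M\<^esub>"
      using c sum_u' by simp
    have d: "(\<lambda>j. c i \<otimes>\<^bsub>R\<^esub> (x \<otimes>\<^bsub>R\<^esub> a j)) \<in> I \<rightarrow> carrier R" "(\<lambda>j. q \<otimes>\<^bsub>R\<^esub> c j) \<in> I \<rightarrow> carrier R"
      "(\<lambda>j. x \<otimes>\<^bsub>R\<^esub> a j) \<in> I \<rightarrow> carrier R"
      using a c q ci x by auto
    \<comment> \<open>Multiplying the relation by \<open>q\<close> turns it into one among the \<open>u j\<close> whose
      coefficient at \<open>u i\<close> is \<open>c i\<close>.\<close>
    have "\<zero>\<^bsub>M\<^esub> = q \<odot>\<^bsub>M\<^esub> (c i \<odot>\<^bsub>M\<^esub> v' \<oplus>\<^bsub>M\<^esub> S c)"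
      using q by (simp add: zero)
    also have "\<dots> = c i \<odot>\<^bsub>M\<^esub> (q \<odot>\<^bsub>M\<^esub> v') \<oplus>\<^bsub>M\<^esub> q \<odot>\<^bsub>M\<^esub> S c"
      using c by (simp add: simps ci smult_assoc1[symmetric] R.m_comm)
    also have "\<dots> = c i \<odot>\<^bsub>M\<^esub> u i \<oplus>\<^bsub>M\<^esub> (c i \<odot>\<^bsub>M\<^esub> (x \<odot>\<^bsub>M\<^esub> S a) \<oplus>\<^bsub>M\<^esub> q \<odot>\<^bsub>M\<^esub> S c)"
      unfolding qv' using c by (simp add: simps ci M.a_assoc)
    also have "\<dots> = (\<Oplus>\<^bsub>M\<^esub>j\<in>I. (if j = i then c i else c i \<otimes>\<^bsub>R\<^esub> (x \<otimes>\<^bsub>R\<^esub> a j) \<oplus>\<^bsub>R\<^esub> q \<otimes>\<^bsub>R\<^esub> c j) \<odot>\<^bsub>M\<^esub> u j)"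
      using d c ci x q a by (subst sum_upd) (auto simp: S_smult S_add)
    finally have sum0: "\<zero>\<^bsub>M\<^esub> = \<dots>" .
    have "(\<lambda>j. if j = i then c i else c i \<otimes>\<^bsub>R\<^esub> (x \<otimes>\<^bsub>R\<^esub> a j) \<oplus>\<^bsub>R\<^esub> q \<otimes>\<^bsub>R\<^esub> c j) \<in> I \<rightarrow> carrier R"
      using d ci by (auto simp: Pi_iff)
    from bspec[OF indep[OF this sum0[symmetric]] i] have "c i = \<zero>\<^bsub>R\<^esub>"
      by simp
    \<comment> \<open>Once \<open>c i\<close> vanishes, the relation no longer involves
      \<open>v'\<close> and is a relation of the old family.\<close>
    moreover from this have "(\<Oplus>\<^bsub>M\<^esub>j\<in>I. c j \<odot>\<^bsub>M\<^esub> u j) = \<zero>\<^bsub>M\<^esub>"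
      using zero c v' ui by (simp add: sum_u)
    ultimately show ?thesis
      using indep c by blast
  qed
  moreover have "\<exists>c\<in>I \<rightarrow> carrier R. z = (\<Oplus>\<^bsub>M\<^esub>j\<in>I. c j \<odot>\<^bsub>M\<^esub> (u(i := v')) j)"
    if z: "z \<in> adjoin R M v N" for z
  proof -
    obtain r n where r: "r \<in> carrier R" "n \<in> N" "z = r \<odot>\<^bsub>M\<^esub> v \<oplus>\<^bsub>M\<^esub> n"
      using z by (auto simp: mem_adjoin_iff)
    then obtain m where m: "m \<in> I \<rightarrow> carrier R" "n = (\<Oplus>\<^bsub>M\<^esub>j\<in>I. m j \<odot>\<^bsub>M\<^esub> u j)"
      using gen by blast
    have mi: "m i \<in> carrier R" using m i by auto
    \<comment> \<open>The total coefficient of \<open>S a\<close> after \<open>v_eq\<close> and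
      \<open>ui_eq\<close> are substituted into r v + m_i u_i + S m.\<close>
    define t where "t = r \<otimes>\<^bsub>R\<^esub> y \<oplus>\<^bsub>R\<^esub> m i \<otimes>\<^bsub>R\<^esub> (\<ominus>\<^bsub>R\<^esub> x)"
    have t: "t \<in> carrier R" using r mi x y by (simp add: t_def)
    define c where "c j = (if j = i then r \<otimes>\<^bsub>R\<^esub> a i \<oplus>\<^bsub>R\<^esub> m i \<otimes>\<^bsub>R\<^esub> q else t \<otimes>\<^bsub>R\<^esub> a j \<oplus>\<^bsub>R\<^esub> m j)" for j
    have c: "c \<in> I \<rightarrow> carrier R"
      using r(1) m(1) mi ai t a q by (auto simp: c_def Pi_iff)
    have ta: "(\<lambda>j. t \<otimes>\<^bsub>R\<^esub> a j) \<in> I \<rightarrow> carrier R"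
      using t a by auto
    have Sceq: "S c = t \<odot>\<^bsub>M\<^esub> S a \<oplus>\<^bsub>M\<^esub> S m"
    proof -
      have "S c = S (\<lambda>j. t \<otimes>\<^bsub>R\<^esub> a j \<oplus>\<^bsub>R\<^esub> m j)"
        unfolding S_def using ta m uc by (intro M.finsum_cong') (auto simp: c_def Pi_iff)
      then show ?thesis
        using t a m ta by (simp add: S_smult S_add)
    qed
    have "z = r \<odot>\<^bsub>M\<^esub> (a i \<odot>\<^bsub>M\<^esub> v' \<oplus>\<^bsub>M\<^esub> y \<odot>\<^bsub>M\<^esub> S a) \<oplus>\<^bsub>M\<^esub>
        (m i \<odot>\<^bsub>M\<^esub> (q \<odot>\<^bsub>M\<^esub> v' \<oplus>\<^bsub>M\<^esub> (\<ominus>\<^bsub>R\<^esub> x) \<odot>\<^bsub>M\<^esub> S a) \<oplus>\<^bsub>M\<^esub> S m)"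
      unfolding r(3) m(2) sum_u[OF m(1)] using v_eq ui_eq by simp
    also have "\<dots> = c i \<odot>\<^bsub>M\<^esub> v' \<oplus>\<^bsub>M\<^esub> S c"
      unfolding Sceq unfolding c_def t_def using r(1) mi m(1)
      by (simp add: simps smult_assoc1 M.a_ac)
    also have "\<dots> = (\<Oplus>\<^bsub>M\<^esub>j\<in>I. c j \<odot>\<^bsub>M\<^esub> (u(i := v')) j)"
      using sum_u'[OF c] by simp
    finally show ?thesis using c by blast
  qed
  ultimately show ?thesis
    unfolding basis_family_submodule_iff[OF P I one] v'_def by blast
qed

end

lemma finite_direct_sum_cong:
  assumes "\<And>i. i \<in> I \<Longrightarrow> N i = N' i"
  shows "finite_direct_sum I N = finite_direct_sum I N'"
  using assms by (simp add: finite_direct_sum_def fun_eq_iff restrict_def cong: PiE_cong)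

context module
begin

lemma finsum_mem_submodule:
  assumes N: "submodule R N M" and "f \<in> I \<rightarrow> N" "finite I"
  shows "(\<Oplus>\<^bsub>M\<^esub>i\<in>I. f i) \<in> N"
  using assms(3,2)
proof (induction I rule: finite_induct)
  case empty
  then show ?case using submodule.zero_closed[OF N] by simp
next
  case (insert i I)
  have "f \<in> I \<rightarrow> carrier M" "f i \<in> carrier M"
    using insert.prems submodule.subset[OF N] by auto
  then show ?case
    using insert submodule.m_closed[OF N] by simp
qed

lemma carrier_submodule: "submodule R (carrier M) M"
  by (rule submodule.intro) (auto intro: module_axioms)

text \<open>Comparing coordinates, r x = 0 forces r c_j = 0 for each coordinate c_j, and R is a
  domain. It serves to cancel p in L.\<close>

lemma basis_family_torsion_free:
  assumes "domain R" "basis_family R M I b" "finite I"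
    and r: "r \<in> carrier R" "r \<noteq> \<zero>\<^bsub>R\<^esub>" and x: "x \<in> carrier M" "r \<odot>\<^bsub>M\<^esub> x = \<zero>\<^bsub>M\<^esub>"
  shows "x = \<zero>\<^bsub>M\<^esub>"
proof -
  interpret domain R by fact
  have "basis_family R (M\<lparr>carrier := carrier M\<rparr>) I b"
    using assms(2) by simp
  then have b: "b \<in> I \<rightarrow> carrier M"
    and indep: "\<And>c. c \<in> I \<rightarrow> carrier R \<Longrightarrow> (\<Oplus>\<^bsub>M\<^esub>j\<in>I. c j \<odot>\<^bsub>M\<^esub> b j) = \<zero>\<^bsub>M\<^esub> \<Longrightarrow> \<forall>j\<in>I. c j = \<zero>\<^bsub>R\<^esub>"
    and gen: "\<exists>c\<in>I \<rightarrow> carrier R. x = (\<Oplus>\<^bsub>M\<^esub>j\<in>I. c j \<odot>\<^bsub>M\<^esub> b j)"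
    using x unfolding basis_family_submodule_iff[OF carrier_submodule assms(3) one_not_zero] by blast+
  from gen obtain c where c: "c \<in> I \<rightarrow> carrier R" "x = (\<Oplus>\<^bsub>M\<^esub>j\<in>I. c j \<odot>\<^bsub>M\<^esub> b j)" by blast
  have "r \<odot>\<^bsub>M\<^esub> x = (\<Oplus>\<^bsub>M\<^esub>j\<in>I. r \<odot>\<^bsub>M\<^esub> (c j \<odot>\<^bsub>M\<^esub> b j))"
    unfolding c(2) using c(1) b r by (intro finsum_smult) auto
  also have "\<dots> = (\<Oplus>\<^bsub>M\<^esub>j\<in>I. (r \<otimes>\<^bsub>R\<^esub> c j) \<odot>\<^bsub>M\<^esub> b j)"
    using c(1) b r by (intro M.finsum_cong') (auto simp: Pi_iff smult_assoc1)
  finally have "(\<Oplus>\<^bsub>M\<^esub>j\<in>I. (r \<otimes>\<^bsub>R\<^esub> c j) \<odot>\<^bsub>M\<^esub> b j) = \<zero>\<^bsub>M\<^esub>"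
    using x by simp
  moreover have "(\<lambda>j. r \<otimes>\<^bsub>R\<^esub> c j) \<in> I \<rightarrow> carrier R"
    using c(1) r by auto
  ultimately have zero: "\<forall>j\<in>I. r \<otimes>\<^bsub>R\<^esub> c j = \<zero>\<^bsub>R\<^esub>"
    using indep by blast
  have "c j = \<zero>\<^bsub>R\<^esub>" if "j \<in> I" for j
  proof -
    have "c j \<in> carrier R" using c(1) that by blast
    then show ?thesis using zero that r integral[of r "c j"] by blast
  qed
  moreover have "b j \<in> carrier M" if "j \<in> I" for j
    using b that by blast
  ultimately show ?thesis
    unfolding c(2) by (intro finsum_all0) simp
qed

text \<open>The map sending r to the class of r v is onto, since elements of \<open>N\<close> vanish
  in the quotient, and by \<open>ann\<close> its kernel is (d). The resulting isomorphism starts at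
  R/(d) and has to be inverted.\<close>

lemma adjoin_quotient_isomorphic_cyclic:
  assumes N: "submodule R N M" and v: "v \<in> carrier M" and d: "d \<in> carrier R"
    and ann: "\<And>r. r \<in> carrier R \<Longrightarrow> r \<odot>\<^bsub>M\<^esub> v \<in> N \<longleftrightarrow> d divides\<^bsub>R\<^esub> r"
  shows "module_isomorphic R (quot_module (M\<lparr>carrier := adjoin R M v N\<rparr>) N) (cyclic_module R d)"
proof -
  let ?P = "M\<lparr>carrier := adjoin R M v N\<rparr>"
  let ?Q = "quot_module ?P N"
  have Nc: "x \<in> carrier M" if "x \<in> N" for x
    using that submodule.subset[OF N] by blast
  have P: "module R ?P"
    by (rule submodule_is_module[OF adjoin_submodule[OF N v]])
  interpret P: module R ?P by fact
  have NP: "x \<in> adjoin R M v N" if "x \<in> N" for x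
    unfolding mem_adjoin_iff using v Nc[OF that] that
    by (intro bexI[of _ "\<zero>\<^bsub>R\<^esub>"] bexI[of _ x]) auto
  have rv: "r \<odot>\<^bsub>M\<^esub> v \<in> adjoin R M v N" if "r \<in> carrier R" for r
    unfolding mem_adjoin_iff using v submodule.zero_closed[OF N] that
    by (intro bexI[of _ r] bexI[of _ "\<zero>\<^bsub>M\<^esub>"]) auto
  have N': "submodule R N ?P"
    by (rule submodule.intro[OF P])
      (use NP submodule.m_closed[OF N] submodule.zero_closed[OF N] submodule.smult_closed[OF N] in auto)
  let ?c = "\<lambda>x. N +>\<^bsub>?P\<^esub> x"
  interpret c: mod_hom R ?P ?Q ?c
    by (rule P.coset_mod_hom[OF N'])
  have "mod_hom R (ring_as_module R) ?Q (\<lambda>r. ?c (r \<odot>\<^bsub>M\<^esub> v))"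
  proof (rule mod_homI[OF R.ring_as_module_is_module c.N.module_axioms])
    fix r assume "r \<in> carrier (ring_as_module R)"
    then show "?c (r \<odot>\<^bsub>M\<^esub> v) \<in> carrier ?Q"
      using rv c.f_im by (auto simp: ring_as_module_def)
  next
    fix r s assume "r \<in> carrier (ring_as_module R)" "s \<in> carrier (ring_as_module R)"
    then have rs: "r \<in> carrier R" "s \<in> carrier R"
      by (auto simp: ring_as_module_def)
    then show "?c ((r \<oplus>\<^bsub>ring_as_module R\<^esub> s) \<odot>\<^bsub>M\<^esub> v) = ?c (r \<odot>\<^bsub>M\<^esub> v) \<oplus>\<^bsub>?Q\<^esub> ?c (s \<odot>\<^bsub>M\<^esub> v)"
      using c.f_add[of "r \<odot>\<^bsub>M\<^esub> v" "s \<odot>\<^bsub>M\<^esub> v"] rv v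
      by (simp add: ring_as_module_def smult_l_distr)
  next
    fix r s assume "r \<in> carrier R" "s \<in> carrier (ring_as_module R)"
    then have rs: "r \<in> carrier R" "s \<in> carrier R"
      by (auto simp: ring_as_module_def)
    then show "?c ((r \<odot>\<^bsub>ring_as_module R\<^esub> s) \<odot>\<^bsub>M\<^esub> v) = r \<odot>\<^bsub>?Q\<^esub> ?c (s \<odot>\<^bsub>M\<^esub> v)"
      using c.f_smult[of r "s \<odot>\<^bsub>M\<^esub> v"] rv v
      by (simp add: ring_as_module_def smult_assoc1)
  qed
  moreover have "(\<lambda>r. ?c (r \<odot>\<^bsub>M\<^esub> v)) ` carrier (ring_as_module R) = carrier ?Q"
  proof -
    have "?c (r \<odot>\<^bsub>M\<^esub> v \<oplus>\<^bsub>M\<^esub> n) = ?c (r \<odot>\<^bsub>M\<^esub> v)" if "r \<in> carrier R" "n \<in> N" for r n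
    proof -
      interpret N: abelian_subgroup N M
        by (rule submodule_abelian_subgroup[OF N])
      have "r \<odot>\<^bsub>M\<^esub> v \<oplus>\<^bsub>M\<^esub> n \<in> N +>\<^bsub>M\<^esub> (r \<odot>\<^bsub>M\<^esub> v)"
        using that Nc[OF that(2)] v by (auto simp: a_r_coset_def' M.a_comm)
      then have "N +>\<^bsub>M\<^esub> (r \<odot>\<^bsub>M\<^esub> v) = N +>\<^bsub>M\<^esub> (r \<odot>\<^bsub>M\<^esub> v \<oplus>\<^bsub>M\<^esub> n)"
        using that v N.a_subgroup
        by (intro M.a_repr_independence) auto
      \<comment> \<open>A coset depends only on the addition, which the restricted record shares
        with \<open>M\<close>.\<close>
      then show ?thesis
        by (simp add: a_r_coset_def')
    qed
    then have "?c ` adjoin R M v N = (\<lambda>r. ?c (r \<odot>\<^bsub>M\<^esub> v)) ` carrier R"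
      using rv by (auto simp: mem_adjoin_iff image_iff) (metis+)
    then show ?thesis
      using P.carrier_quot_module[of N] by (simp add: ring_as_module_def)
  qed
  moreover have "?c (r \<odot>\<^bsub>M\<^esub> v) = \<zero>\<^bsub>?Q\<^esub> \<longleftrightarrow> r \<in> PIdl\<^bsub>R\<^esub> d" if "r \<in> carrier (ring_as_module R)" for r
  proof -
    have r: "r \<in> carrier R" using that by (simp add: ring_as_module_def)
    have "?c (r \<odot>\<^bsub>M\<^esub> v) = \<zero>\<^bsub>?Q\<^esub> \<longleftrightarrow> ?c (r \<odot>\<^bsub>M\<^esub> v) = N"
      by (simp add: quot_module_def)
    also have "\<dots> \<longleftrightarrow> r \<odot>\<^bsub>M\<^esub> v \<in> N"
      using P.coset_eq_self_iff[OF N'] rv[OF r] by simp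
    finally show ?thesis
      using ann[OF r] R.mem_PIdl_iff[OF d] by simp
  qed
  ultimately have "module_isomorphic R (cyclic_module R d) ?Q"
    unfolding cyclic_module_def
    by (intro iffD2[OF module_isomorphic_quot_iff[OF R.ring_as_module_is_module R.PIdl_submodule[OF d]]]
        exI[of _ "\<lambda>r. ?c (r \<odot>\<^bsub>M\<^esub> v)"]) blast
  then show ?thesis by (rule module_isomorphic_sym)
qed

end

section \<open>Elementary divisors\<close>

theorem mainTheorem4:
  fixes R :: "('a, 'r) ring_scheme" and L :: "('a, 'b, 'l) module_scheme"
    and M :: "'b set" and u :: "nat \<Rightarrow> 'b" and p :: 'a and ds :: "'a list"
    and \<epsilon> :: "nat \<Rightarrow> nat" and f k e :: nat
  assumes R: "principal_domain R"
    and f: "f \<ge> 1"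
    and L: "free_of_rank R L f"
    and M: "submodule R M L" "M \<subset> carrier L"
    and u: "basis_family R (L\<lparr>carrier := M\<rparr>) {1..f} u"
    and p: "p \<in> carrier R" "ring_prime\<^bsub>R\<^esub> p"
    and ds: "elementary_divisors R (quot_module L M) ds"
    and k: "k \<ge> 1"
    and \<epsilon>: "1 \<le> \<epsilon> 1" "\<forall>i\<in>{1..k}. \<forall>j\<in>{1..k}. i \<le> j \<longrightarrow> \<epsilon> i \<le> \<epsilon> j"
    and p_ds: "essentially_equal R (p_part R p ds) (map (\<lambda>i. p [^]\<^bsub>R\<^esub> \<epsilon> i) [1..<Suc k])"
    and e: "e = \<epsilon> k"
  shows "(\<exists>v a. is_witness R L M f u p e v a) \<and>
    (\<forall>v a. is_witness R L M f u p e v a \<longrightarrow>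
       (let P = adjoin R L v M in
          submodule R P L \<and>
          module_isomorphic R (quot_module (L\<lparr>carrier := P\<rparr>) M) (cyclic_module R (p [^]\<^bsub>R\<^esub> e)) \<and>
          (\<exists>ds'. essentially_equal R ds (p [^]\<^bsub>R\<^esub> e # ds') \<and>
                 elementary_divisors R (quot_module L P) ds'))) \<and>
    (\<forall>v a. is_witness R L M f u p e v a \<longrightarrow>
       (\<exists>i\<in>{1..f}. \<not> p divides\<^bsub>R\<^esub> a i) \<and>
       (\<forall>i\<in>{1..f}. \<forall>x\<in>carrier R. \<forall>y\<in>carrier R.
          \<not> p divides\<^bsub>R\<^esub> a i \<and>
          x \<otimes>\<^bsub>R\<^esub> a i \<oplus>\<^bsub>R\<^esub> y \<otimes>\<^bsub>R\<^esub> p [^]\<^bsub>R\<^esub> e = \<one>\<^bsub>R\<^esub> \<longrightarrow>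
          basis_family R (L\<lparr>carrier := adjoin R L v M\<rparr>) {1..f}
            (u(i := x \<odot>\<^bsub>L\<^esub> v \<oplus>\<^bsub>L\<^esub> y \<odot>\<^bsub>L\<^esub> u i))))"
proof -
  interpret R: principal_domain R by fact
  obtain b where L_module: "module R L" and b: "basis_family R L {1..f} b"
    using L by (auto simp: free_of_rank_def)
  interpret L: module R L by fact
  have one: "\<one>\<^bsub>R\<^esub> \<noteq> \<zero>\<^bsub>R\<^esub>" by simp
  have Mc: "x \<in> carrier L" if "x \<in> M" for x
    using that M(2) by blast
  have uM: "u \<in> {1..f} \<rightarrow> M"
    and gen: "\<And>x. x \<in> M \<Longrightarrow> \<exists>a\<in>{1..f} \<rightarrow> carrier R. x = (\<Oplus>\<^bsub>L\<^esub>i\<in>{1..f}. a i \<odot>\<^bsub>L\<^esub> u i)"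
    using u unfolding L.basis_family_submodule_iff[OF M(1) finite_atLeastAtMost one] by blast+
  have comb_mem: "(\<Oplus>\<^bsub>L\<^esub>i\<in>{1..f}. a i \<odot>\<^bsub>L\<^esub> u i) \<in> M" if "a \<in> {1..f} \<rightarrow> carrier R" for a
    using that uM submodule.smult_closed[OF M(1)]
    by (intro L.finsum_mem_submodule[OF M(1)]) auto

  \<comment> \<open>The largest exponent of p among the elementary divisors\<close>
  have "\<epsilon> k \<ge> 1"
    using \<epsilon> k by (metis atLeastAtMost_iff le_refl order_trans)
  then obtain e0 where e0: "e = Suc e0"
    using e Suc_le_D by auto
  let ?ps = "map (\<lambda>i. p [^]\<^bsub>R\<^esub> \<epsilon> i) [1..<Suc k]"
  obtain qs where qs: "mset qs = mset (p_part R p ds)" "list_all2 (\<sim>\<^bsub>R\<^esub>) qs ?ps"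
    using p_ds by (auto simp: essentially_equal_def)
  have len_qs: "length qs = k"
    using list_all2_lengthD[OF qs(2)] by (simp del: upt_Suc)
  \<comment> \<open>\<open>qs\<close> is the p-part reordered to match the given powers. List
    positions start at 0 and exponents at 1, so the largest exponent sits at position
    \<open>k - 1\<close>.\<close>
  have qs_nth: "qs ! n \<sim>\<^bsub>R\<^esub> p [^]\<^bsub>R\<^esub> \<epsilon> (Suc n)" if "n < k" for n
    using list_all2_nthD[OF qs(2), of n] that by (simp add: len_qs del: upt_Suc)
  have set_qs: "set qs = set (p_part R p ds)"
    using qs(1) by (rule mset_eq_setD)
  \<comment> \<open>For m > 0 such an entry belongs to the p-part, so m is bounded by some
    \<open>\<epsilon> (Suc n)\<close> and hence by \<open>\<epsilon> k\<close>; for m = 0 the bound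
    is trivial.\<close>
  have max: "m \<le> Suc e0" if d: "d \<in> set ds" "d \<sim>\<^bsub>R\<^esub> p [^]\<^bsub>R\<^esub> m" for d and m :: nat
  proof (cases "m = 0")
    case False
    then have "d \<in> set qs"
      using d by (auto simp: set_qs p_part_def power_upto_unit_def intro!: exI[of _ m])
    then obtain n where n: "n < length qs" "qs ! n = d"
      by (auto simp: in_set_conv_nth)
    then have nk: "n < k" and dn: "d \<sim>\<^bsub>R\<^esub> p [^]\<^bsub>R\<^esub> \<epsilon> (Suc n)"
      using qs_nth by (auto simp: len_qs)
    have "p [^]\<^bsub>R\<^esub> m divides\<^bsub>R\<^esub> p [^]\<^bsub>R\<^esub> \<epsilon> (Suc n)"
      using R.divides_trans[OF associatedD[OF R.associated_sym[OF d(2)]] associatedD[OF dn]] p(1)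
      by simp
    then have "m \<le> \<epsilon> (Suc n)"
      using R.prime_nat_pow_divides_imp_le p by blast
    also have "\<dots> \<le> \<epsilon> k"
      using \<epsilon>(2) nk by auto
    finally show ?thesis
      using e e0 by simp
  qed simp
  have "qs ! (k - 1) \<in> set ds" "qs ! (k - 1) \<sim>\<^bsub>R\<^esub> p [^]\<^bsub>R\<^esub> Suc e0"
    using qs_nth[of "k - 1"] nth_mem[of "k - 1" qs] k e e0
    by (auto simp: len_qs set_qs p_part_def simp del: nth_mem)
  then obtain j where j: "j < length ds" "ds ! j \<sim>\<^bsub>R\<^esub> p [^]\<^bsub>R\<^esub> Suc e0"
    by (auto simp: in_set_conv_nth)

  \<comment> \<open>L/M as a direct sum of cyclic modules\<close>
  let ?C = "\<lambda>i. cyclic_module R (ds ! i)"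
  define D where "D = finite_direct_sum {..<length ds} ?C"
  have ds_carrier: "ds ! i \<in> carrier R" if "i < length ds" for i
    using ds that by (auto simp: elementary_divisors_def)
  have C: "module R (?C i)" if "i < length ds" for i
    using ds_carrier[OF that] by (rule R.cyclic_module_is_module)
  note Ds = finite_direct_sum_simps[where I="{..<length ds}" and N="?C", folded D_def]
  \<comment> \<open>\<open>H\<close> is reduction modulo M followed by the given isomorphism;
    membership in M becomes vanishing in \<open>D\<close>.\<close>
  obtain H where H: "mod_hom R L D H" "H ` carrier L = carrier D"
    and H0: "\<And>x. x \<in> carrier L \<Longrightarrow> H x = \<zero>\<^bsub>D\<^esub> \<longleftrightarrow> x \<in> M"
    using ds unfolding elementary_divisors_def module_isomorphic_quot_iff[OF L_module M(1)] D_def[symmetric]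
    by blast
  interpret H: mod_hom R L D H by fact
  have pc: "p [^]\<^bsub>R\<^esub> n \<in> carrier R" for n :: nat
    using p(1) by simp

  have witness_ex: "\<exists>v a. is_witness R L M f u p e v a"
  proof -
    \<comment> \<open>The class of 1 in a summand R/(p^e), zero elsewhere: its annihilator is
      generated by \<open>ds ! j\<close>, so any preimage in L is a witness.\<close>
    define z where "z = (\<lambda>i\<in>{..<length ds}. if i = j
      then PIdl\<^bsub>R\<^esub> (ds ! j) +>\<^bsub>ring_as_module R\<^esub> \<one>\<^bsub>R\<^esub> else \<zero>\<^bsub>?C i\<^esub>)"
    have zc: "z i \<in> carrier (?C i)" if "i < length ds" for i
    proof -
      interpret C: module R "?C i" by (rule C[OF that])
      show ?thesis
        using that by (cases "i = j") (simp_all add: z_def R.carrier_cyclic_module[of "ds ! j"])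
    qed
    then have "z \<in> carrier D"
      by (auto simp: Ds z_def)
    then obtain v where v: "v \<in> carrier L" "H v = z"
      unfolding H(2)[symmetric] by blast
    have smult_z: "r \<odot>\<^bsub>D\<^esub> z = \<zero>\<^bsub>D\<^esub> \<longleftrightarrow> ds ! j divides\<^bsub>R\<^esub> r" if r: "r \<in> carrier R" for r
    proof -
      have "r \<odot>\<^bsub>D\<^esub> z = \<zero>\<^bsub>D\<^esub> \<longleftrightarrow> (\<forall>i<length ds. r \<odot>\<^bsub>?C i\<^esub> z i = \<zero>\<^bsub>?C i\<^esub>)"
        by (auto simp: Ds fun_eq_iff restrict_def)
      also have "\<dots> \<longleftrightarrow> r \<odot>\<^bsub>?C j\<^esub> z j = \<zero>\<^bsub>?C j\<^esub>"
        using j(1) module.smult_r_null[OF C r] by (auto simp: z_def)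
      also have "\<dots> \<longleftrightarrow> ds ! j divides\<^bsub>R\<^esub> r"
        using j(1) r R.smult_cyclic_module[OF ds_carrier[OF j(1)] r R.one_closed]
          R.cyclic_module_eq_zero_iff[OF ds_carrier[OF j(1)] r]
        by (simp add: z_def)
      finally show ?thesis .
    qed
    have smult_v: "r \<odot>\<^bsub>L\<^esub> v \<in> M \<longleftrightarrow> ds ! j divides\<^bsub>R\<^esub> r" if r: "r \<in> carrier R" for r
      using H0[of "r \<odot>\<^bsub>L\<^esub> v"] H.f_smult[of r v] v r smult_z[OF r] by simp
    have "p [^]\<^bsub>R\<^esub> e \<odot>\<^bsub>L\<^esub> v \<in> M"
      unfolding smult_v[OF pc] e0 using j(2) by (rule associatedD)
    then obtain a where a: "a \<in> {1..f} \<rightarrow> carrier R"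
      "p [^]\<^bsub>R\<^esub> e \<odot>\<^bsub>L\<^esub> v = (\<Oplus>\<^bsub>L\<^esub>i\<in>{1..f}. a i \<odot>\<^bsub>L\<^esub> u i)"
      using gen by blast
    have "\<not> ds ! j divides\<^bsub>R\<^esub> p [^]\<^bsub>R\<^esub> e0"
    proof
      assume "ds ! j divides\<^bsub>R\<^esub> p [^]\<^bsub>R\<^esub> e0"
      then have "p [^]\<^bsub>R\<^esub> Suc e0 divides\<^bsub>R\<^esub> p [^]\<^bsub>R\<^esub> e0"
        by (rule R.divides_trans[OF associatedD[OF R.associated_sym[OF j(2)]] _ pc])
      then have "Suc e0 \<le> e0"
        by (rule R.prime_nat_pow_divides_imp_le[OF p(2,1)])
      then show False by simp
    qed
    then have "p [^]\<^bsub>R\<^esub> e0 \<odot>\<^bsub>L\<^esub> v \<notin> M"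
      unfolding smult_v[OF pc] .
    then have "is_witness R L M f u p e v a"
      using a v by (simp add: is_witness_def e0)
    then show ?thesis by blast
  qed

  \<comment> \<open>The quotients P/M and L/P\<close>
  have part_ii: "submodule R (adjoin R L v M) L \<and>
      module_isomorphic R (quot_module (L\<lparr>carrier := adjoin R L v M\<rparr>) M) (cyclic_module R (p [^]\<^bsub>R\<^esub> e)) \<and>
      (\<exists>ds'. essentially_equal R ds (p [^]\<^bsub>R\<^esub> e # ds') \<and>
             elementary_divisors R (quot_module L (adjoin R L v M)) ds')"
    if "is_witness R L M f u p e v a" for v a
  proof (intro conjI)
    have v: "v \<in> carrier L" and a: "a \<in> {1..f} \<rightarrow> carrier R"
      and pv: "p [^]\<^bsub>R\<^esub> Suc e0 \<odot>\<^bsub>L\<^esub> v = (\<Oplus>\<^bsub>L\<^esub>i\<in>{1..f}. a i \<odot>\<^bsub>L\<^esub> u i)"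
      and pv': "p [^]\<^bsub>R\<^esub> e0 \<odot>\<^bsub>L\<^esub> v \<notin> M"
      using that by (auto simp: is_witness_def e0)
    have H_rv: "r \<odot>\<^bsub>D\<^esub> H v = \<zero>\<^bsub>D\<^esub> \<longleftrightarrow> r \<odot>\<^bsub>L\<^esub> v \<in> M" if "r \<in> carrier R" for r
      using H0[of "r \<odot>\<^bsub>L\<^esub> v"] H.f_smult[of r v] v that by simp
    have pv_mem: "p [^]\<^bsub>R\<^esub> Suc e0 \<odot>\<^bsub>L\<^esub> v \<in> M"
      unfolding pv by (rule comb_mem[OF a])
    have w: "H v \<in> carrier D" "p [^]\<^bsub>R\<^esub> Suc e0 \<odot>\<^bsub>D\<^esub> H v = \<zero>\<^bsub>D\<^esub>"
      "p [^]\<^bsub>R\<^esub> e0 \<odot>\<^bsub>D\<^esub> H v \<noteq> \<zero>\<^bsub>D\<^esub>"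
      using H.f_im v pv_mem pv' H_rv[OF pc] by blast+
    have ds_elem: "d \<in> carrier R \<and> (\<exists>q\<in>carrier R. ring_prime\<^bsub>R\<^esub> q \<and> power_upto_unit R q d)"
      if "d \<in> set ds" for d
      using ds that unfolding elementary_divisors_def by blast
    \<comment> \<open>This index depends on \<open>v\<close> and need not be the one used to
      construct a witness.\<close>
    obtain j where j: "j < length ds" "ds ! j \<sim>\<^bsub>R\<^esub> p [^]\<^bsub>R\<^esub> Suc e0"
      and gen_j: "\<And>z. z \<in> carrier (?C j) \<Longrightarrow> \<exists>r\<in>carrier R. z = r \<odot>\<^bsub>?C j\<^esub> H v j"
      and ann_j: "\<And>r. r \<in> carrier R \<Longrightarrow> r \<odot>\<^bsub>?C j\<^esub> H v j = \<zero>\<^bsub>?C j\<^esub> \<Longrightarrow> p [^]\<^bsub>R\<^esub> Suc e0 divides\<^bsub>R\<^esub> r"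
      by (rule R.direct_sum_cyclic_component[OF _ p(2,1) _ w[unfolded D_def]])
        (erule ds_elem, erule max, assumption, blast)
    \<comment> \<open>Together with \<open>zero_dvd\<close>: the annihilator of \<open>H v\<close>
      is generated by p^e. This yields P/M directly, and it shows that \<open>H v\<close> has no
      larger order than its coordinate \<open>j\<close>.\<close>
    have dvd_zero: "r \<odot>\<^bsub>D\<^esub> H v = \<zero>\<^bsub>D\<^esub>"
      if dvd: "p [^]\<^bsub>R\<^esub> Suc e0 divides\<^bsub>R\<^esub> r" for r
    proof -
      obtain t where t: "t \<in> carrier R" "r = p [^]\<^bsub>R\<^esub> Suc e0 \<otimes>\<^bsub>R\<^esub> t"
        using dvd unfolding factor_def by blast
      show ?thesis
        unfolding t(2) R.m_comm[OF pc t(1)] H.N.smult_assoc1[OF t(1) pc w(1)] w(2)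
        by (rule H.N.smult_r_null[OF t(1)])
    qed
    have zero_dvd: "p [^]\<^bsub>R\<^esub> Suc e0 divides\<^bsub>R\<^esub> r"
      if r: "r \<in> carrier R" "r \<odot>\<^bsub>D\<^esub> H v = \<zero>\<^bsub>D\<^esub>" for r
      using fun_cong[OF r(2), of j] j(1) by (intro ann_j r) (simp add: Ds)
    show "submodule R (adjoin R L v M) L"
      by (rule L.adjoin_submodule[OF M(1) v])
    show "module_isomorphic R (quot_module (L\<lparr>carrier := adjoin R L v M\<rparr>) M) (cyclic_module R (p [^]\<^bsub>R\<^esub> e))"
    proof (rule L.adjoin_quotient_isomorphic_cyclic[OF M(1) v pc])
      fix r assume "r \<in> carrier R"
      then show "r \<odot>\<^bsub>L\<^esub> v \<in> M \<longleftrightarrow> p [^]\<^bsub>R\<^esub> e divides\<^bsub>R\<^esub> r"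
        unfolding e0 using H_rv dvd_zero zero_dvd by blast
    qed

    define ds' where "ds' = take j ds @ drop (Suc j) ds"
    \<comment> \<open>The increasing enumeration that skips \<open>j\<close>, matching the deletion
      in \<open>ds'\<close>.\<close>
    define \<sigma> where "\<sigma> i = (if i < j then i else Suc i)" for i
    have len: "length ds = Suc (length ds')"
      using j(1) by (simp add: ds'_def)
    have nth: "ds' ! i = ds ! \<sigma> i" if "i < length ds'" for i
      using that j(1) by (auto simp: ds'_def \<sigma>_def nth_append min_def)
    have \<sigma>: "bij_betw \<sigma> {..<length ds'} ({..<length ds} - {j})"
      by (rule bij_betwI[where g = "\<lambda>i. if i < j then i else i - 1"])
        (use len j(1) in \<open>auto simp: \<sigma>_def split: if_splits\<close>)
    let ?D' = "finite_direct_sum {..<length ds'} (\<lambda>i. cyclic_module R (ds' ! i))"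
    have D': "?D' = finite_direct_sum {..<length ds'} (\<lambda>i. ?C (\<sigma> i))"
      by (rule finite_direct_sum_cong) (simp add: nth)
    obtain T where T: "mod_hom R D ?D' T" "T ` carrier D = carrier ?D'"
      and T0: "\<And>z. z \<in> carrier D \<Longrightarrow> T z = \<zero>\<^bsub>?D'\<^esub> \<longleftrightarrow> (\<exists>r\<in>carrier R. z = r \<odot>\<^bsub>D\<^esub> H v)"
    proof (rule finite_direct_sum_mod_cyclic[of R "{..<length ds}" ?C j \<sigma> "{..<length ds'}" "H v",
          folded D_def D'])
      fix r assume "r \<in> carrier R" "r \<odot>\<^bsub>?C j\<^esub> H v j = \<zero>\<^bsub>?C j\<^esub>"
      then show "r \<odot>\<^bsub>D\<^esub> H v = \<zero>\<^bsub>D\<^esub>"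
        by (intro dvd_zero ann_j)
    qed (use R.is_cring C j(1) \<sigma> w(1) gen_j in auto)
    interpret T: mod_hom R D ?D' T by fact
    have TH: "T (H x) = \<zero>\<^bsub>?D'\<^esub> \<longleftrightarrow> x \<in> adjoin R L v M" if x: "x \<in> carrier L" for x
    proof -
      \<comment> \<open>Since \<open>H\<close> has kernel M, the preimage of the cyclic module
        generated by \<open>H v\<close> is Rv + M.\<close>
      have "H x = r \<odot>\<^bsub>D\<^esub> H v \<longleftrightarrow> (\<exists>m\<in>M. x = r \<odot>\<^bsub>L\<^esub> v \<oplus>\<^bsub>L\<^esub> m)" if r: "r \<in> carrier R" for r
      proof
        assume eq: "H x = r \<odot>\<^bsub>D\<^esub> H v"
        let ?m = "\<ominus>\<^bsub>L\<^esub> (r \<odot>\<^bsub>L\<^esub> v) \<oplus>\<^bsub>L\<^esub> x"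
        have "H ?m = (\<ominus>\<^bsub>R\<^esub> r) \<odot>\<^bsub>D\<^esub> H v \<oplus>\<^bsub>D\<^esub> H x"
          using H.f_add[of "(\<ominus>\<^bsub>R\<^esub> r) \<odot>\<^bsub>L\<^esub> v" x] x v r w(1)
          by (simp add: L.smult_l_minus H.N.smult_l_minus)
        also have "\<dots> = \<zero>\<^bsub>D\<^esub>"
          using r w(1) by (simp add: eq H.N.smult_l_minus H.N.M.l_neg)
        finally have "?m \<in> M"
          using H0[of ?m] x v r by simp
        moreover have "x = r \<odot>\<^bsub>L\<^esub> v \<oplus>\<^bsub>L\<^esub> ?m"
          using x v r by (simp add: L.M.r_neg2)
        ultimately show "\<exists>m\<in>M. x = r \<odot>\<^bsub>L\<^esub> v \<oplus>\<^bsub>L\<^esub> m" by blast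
      next
        assume "\<exists>m\<in>M. x = r \<odot>\<^bsub>L\<^esub> v \<oplus>\<^bsub>L\<^esub> m"
        then obtain m where m: "m \<in> M" "x = r \<odot>\<^bsub>L\<^esub> v \<oplus>\<^bsub>L\<^esub> m" by blast
        then have "H m = \<zero>\<^bsub>D\<^esub>"
          using H0[OF Mc] by simp
        then show "H x = r \<odot>\<^bsub>D\<^esub> H v"
          using m(2) Mc[OF m(1)] v r w(1) by simp
      qed
      then show ?thesis
        using T0[of "H x"] H.f_im x by (auto simp: L.mem_adjoin_iff)
    qed
    have "mod_hom R L ?D' (T \<circ> H)"
      by (rule mod_homI[OF L_module T.N.module_axioms]) (use H.f_im T.f_im in auto)
    moreover have "(T \<circ> H) ` carrier L = carrier ?D'"
      by (simp only: image_comp[symmetric] H(2) T(2))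
    ultimately have "module_isomorphic R (quot_module L (adjoin R L v M)) ?D'"
      using TH
      by (intro iffD2[OF module_isomorphic_quot_iff[OF L_module L.adjoin_submodule[OF M(1) v]]]
          exI[of _ "T \<circ> H"]) simp
    moreover have "set ds' \<subseteq> set ds"
      by (auto simp: ds'_def dest: in_set_takeD in_set_dropD)
    ultimately have "elementary_divisors R (quot_module L (adjoin R L v M)) ds'"
      using ds unfolding elementary_divisors_def by blast
    \<comment> \<open>Moving entry \<open>j\<close> to the front is the permutation; replacing it by
      its associate p^e is the only change of a unit.\<close>
    moreover have "essentially_equal R ds (p [^]\<^bsub>R\<^esub> e # ds')"
      unfolding essentially_equal_def
    proof (intro exI conjI)
      have "ds = take j ds @ ds ! j # drop (Suc j) ds"
        using j(1) by (rule id_take_nth_drop)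
      then have "mset ds = mset (take j ds @ ds ! j # drop (Suc j) ds)"
        by (rule arg_cong)
      then show "mset ds = mset (ds ! j # ds')"
        by (simp add: ds'_def)
      have "list_all2 (\<sim>\<^bsub>R\<^esub>) ds' ds'"
        using \<open>set ds' \<subseteq> set ds\<close> ds by (intro list.rel_refl_strong) (auto simp: elementary_divisors_def)
      then show "list_all2 (\<sim>\<^bsub>R\<^esub>) (ds ! j # ds') (p [^]\<^bsub>R\<^esub> e # ds')"
        using j(2) by (simp add: e0)
    qed
    ultimately show "\<exists>ds'. essentially_equal R ds (p [^]\<^bsub>R\<^esub> e # ds') \<and>
        elementary_divisors R (quot_module L (adjoin R L v M)) ds'" by blast
  qed

  have part_iii: "\<exists>i\<in>{1..f}. \<not> p divides\<^bsub>R\<^esub> a i"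
    if "is_witness R L M f u p e v a" for v a
  proof (rule ccontr)
    have v: "v \<in> carrier L" and a: "a \<in> {1..f} \<rightarrow> carrier R"
      and pv: "p [^]\<^bsub>R\<^esub> Suc e0 \<odot>\<^bsub>L\<^esub> v = (\<Oplus>\<^bsub>L\<^esub>i\<in>{1..f}. a i \<odot>\<^bsub>L\<^esub> u i)"
      and pv': "p [^]\<^bsub>R\<^esub> e0 \<odot>\<^bsub>L\<^esub> v \<notin> M"
      using that by (auto simp: is_witness_def e0)
    assume "\<not> (\<exists>i\<in>{1..f}. \<not> p divides\<^bsub>R\<^esub> a i)"
    then have "\<forall>i\<in>{1..f}. \<exists>c\<in>carrier R. a i = p \<otimes>\<^bsub>R\<^esub> c"
      by (simp add: factor_def)
    then obtain c where c: "\<And>i. i \<in> {1..f} \<Longrightarrow> c i \<in> carrier R"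
      "\<And>i. i \<in> {1..f} \<Longrightarrow> a i = p \<otimes>\<^bsub>R\<^esub> c i"
      by metis
    let ?m = "\<Oplus>\<^bsub>L\<^esub>i\<in>{1..f}. c i \<odot>\<^bsub>L\<^esub> u i"
    have uc: "u i \<in> carrier L" if "i \<in> {1..f}" for i
      using uM Mc that by blast
    have m: "?m \<in> M"
      using c(1) by (intro comb_mem) auto
    \<comment> \<open>Both sides of the relation are p times an element of L. Cancelling p
      identifies p^(e-1) v with a combination of the basis of M, against the choice of
      \<open>v\<close>.\<close>
    have "p \<odot>\<^bsub>L\<^esub> (p [^]\<^bsub>R\<^esub> e0 \<odot>\<^bsub>L\<^esub> v) = (\<Oplus>\<^bsub>L\<^esub>i\<in>{1..f}. a i \<odot>\<^bsub>L\<^esub> u i)"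
      using pv p(1) v by (simp add: L.smult_assoc1[symmetric] R.m_comm)
    also have "\<dots> = (\<Oplus>\<^bsub>L\<^esub>i\<in>{1..f}. p \<odot>\<^bsub>L\<^esub> (c i \<odot>\<^bsub>L\<^esub> u i))"
      using c uc p(1) by (intro L.M.finsum_cong') (auto simp: L.smult_assoc1)
    also have "\<dots> = p \<odot>\<^bsub>L\<^esub> ?m"
      using c(1) uc p(1) by (intro L.finsum_smult[symmetric]) auto
    finally have "p \<odot>\<^bsub>L\<^esub> (p [^]\<^bsub>R\<^esub> e0 \<odot>\<^bsub>L\<^esub> v \<ominus>\<^bsub>L\<^esub> ?m) = \<zero>\<^bsub>L\<^esub>"
      using p(1) v pc Mc[OF m]
      by (simp add: a_minus_def L.smult_r_distr L.smult_r_minus L.M.r_neg)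
    then have "p [^]\<^bsub>R\<^esub> e0 \<odot>\<^bsub>L\<^esub> v \<ominus>\<^bsub>L\<^esub> ?m = \<zero>\<^bsub>L\<^esub>"
      using L.basis_family_torsion_free[OF R.domain_axioms b finite_atLeastAtMost p(1)]
        p(2) v pc Mc[OF m] by (simp add: ring_prime_def)
    then have "p [^]\<^bsub>R\<^esub> e0 \<odot>\<^bsub>L\<^esub> v = ?m"
      using v pc Mc[OF m] by simp
    then show False
      using m pv' by simp
  qed

  show ?thesis
    unfolding Let_def
    using witness_ex part_ii part_iii
      L.basis_family_adjoin[OF M(1) finite_atLeastAtMost one u _ _ pc]
    by (auto simp: is_witness_def)
qed

end
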